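(* Let $n\ge 1$, $p\ge 0$, $R>0$, $T>0$. For every $u\in L^\infty((-T,0];L^2(B_R^+,x_n^p\,dx))\cap L^2((-T,0];H^1_{0,L}(B_R^+))$ one has $$\left(\int_{Q^+_{R,T}}|u|^{2\chi}\,dx\,dt\right)^{1/\chi}\le C\,\|u\|_{V_2(Q^+_{R,T})}^2,$$ where: if $n\ge 3$, then $\chi=\frac{n+p+2}{n+p}$ and $C$ depends only on $n$ and $p$; if $n=1,2$, then $\chi=\frac{p+2}{p+1}$ and $C=C(p)\,R^{\frac{p+2-n}{p+2}}$ with $C(p)$ depending only on $p$.
   Context: Write $x=(x',x_n)\in\mathbb{R}^n$, $B_R$ for the open ball of radius $R$ centered at $0$, $B_R^+=B_R\cap\{x_n>0\}$, and $Q^+_{R,T}=B_R^+\times(-T,0]$. The space $H^1_{0,L}(B_R^+)$ consists of all $u\in H^1(B_R^+)$ with $u=0$ (in the trace sense) on the flat part $\partial'B_R^+=B_R\cap\{x_n=0\}$. The norm is $$\|u\|_{V_2(Q^+_{R,T})}=\left(\sup_{-T<t<0}\int_{B_R^+}u(x,t)^2x_n^p\,dx+\|\nabla u\|_{L^2(B_R^+\times(-T,0])}^2\right)^{1/2},$$ where the supremum is an essential supremum and $\nabla$ is the gradient in $x$. *)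

theory Defs
  imports "HOL-Analysis.Analysis" "HOL-Probability.Essential_Supremum"
begin

text \<open>Throughout, \<open>k\<close> is the index of the distinguished coordinate \<open>x\<^sub>n\<close> of
  \<open>x = (x', x\<^sub>n)\<close>; coordinates of \<^typ>\<open>real^'n\<close> carry no order, so every statement is made
  for an arbitrary \<open>k\<close>.\<close>

definition half_ball :: "'n::finite \<Rightarrow> real \<Rightarrow> (real^'n) set" where
  "half_ball k R = {x. norm x < R \<and> 0 < x $ k}"

definition flat_part :: "'n::finite \<Rightarrow> real \<Rightarrow> (real^'n) set" where
  "flat_part k R = {x. norm x < R \<and> x $ k = 0}"

definition half_cylinder :: "'n::finite \<Rightarrow> real \<Rightarrow> real \<Rightarrow> ((real^'n) \<times> real) set" where
  "half_cylinder k R T = half_ball k R \<times> {-T<..0}"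

text \<open>The \<open>(n-1)\<close>-dimensional Lebesgue measure \<open>dx'\<close> carried by the hyperplane \<open>x\<^sub>n = 0\<close>;
  for \<open>n = 1\<close> it is the unit point mass at \<open>0\<close>.\<close>

definition hyperplane_measure :: "'n::finite \<Rightarrow> (real^'n) measure" where
  "hyperplane_measure k =
     distr (Pi\<^sub>M (UNIV - {k}) (\<lambda>_. lborel)) borel (\<lambda>y. \<chi> i. if i = k then 0 else y i)"

lemma hyperplane_measure_map_measurable:
  "(\<lambda>y. \<chi> i. if i = k then 0 else y i) \<in> Pi\<^sub>M (UNIV - {k}) (\<lambda>_. lborel) \<rightarrow>\<^sub>M (borel :: (real^'n) measure)"
proof -
  have "(\<lambda>y. (if i = k then 0 else y i) :: real)
          \<in> borel_measurable (Pi\<^sub>M (UNIV - {k}) (\<lambda>_. lborel))" for i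
    by (cases "i = k") (auto intro!: measurable_compose[OF measurable_component_singleton])
  then show ?thesis
    by (subst borel_measurable_euclidean_space) (auto simp: Basis_vec_def inner_axis)
qed

section \<open>Smooth functions and weak gradients\<close>

primrec C_k :: "nat \<Rightarrow> (real^'n \<Rightarrow> real) \<Rightarrow> bool" where
  "C_k 0 f \<longleftrightarrow> continuous_on UNIV f"
| "C_k (Suc m) f \<longleftrightarrow> (\<exists>g. (\<forall>x. GDERIV f x :> g x) \<and> (\<forall>i. C_k m (\<lambda>x. g x $ i)))"

definition smooth :: "(real^'n \<Rightarrow> real) \<Rightarrow> bool" where
  "smooth f \<longleftrightarrow> (\<forall>m. C_k m f)"

definition test_function :: "(real^'n) set \<Rightarrow> (real^'n \<Rightarrow> real) \<Rightarrow> bool" where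
  "test_function \<Omega> \<phi> \<longleftrightarrow>
     smooth \<phi> \<and> compact (closure {x. \<phi> x \<noteq> 0}) \<and> closure {x. \<phi> x \<noteq> 0} \<subseteq> \<Omega>"

definition locally_integrable ::
    "(real^'n) set \<Rightarrow> (real^'n \<Rightarrow> 'b::{banach, second_countable_topology}) \<Rightarrow> bool" where
  "locally_integrable \<Omega> f \<longleftrightarrow> (\<forall>K. compact K \<and> K \<subseteq> \<Omega> \<longrightarrow> integrable (lebesgue_on K) f)"

definition has_weak_gradient ::
    "(real^'n) set \<Rightarrow> (real^'n \<Rightarrow> real) \<Rightarrow> (real^'n \<Rightarrow> real^'n) \<Rightarrow> bool" where
  "has_weak_gradient \<Omega> u g \<longleftrightarrow>
     locally_integrable \<Omega> u \<and> locally_integrable \<Omega> g \<and>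
     (\<forall>\<phi> d\<phi>. test_function \<Omega> \<phi> \<and> (\<forall>x. GDERIV \<phi> x :> d\<phi> x) \<longrightarrow>
        (LINT x|lebesgue_on \<Omega>. u x *\<^sub>R d\<phi> x) = - (LINT x|lebesgue_on \<Omega>. \<phi> x *\<^sub>R g x))"

text \<open>A representative of the weak gradient, which is unique up to null sets; it is only
  meaningful if a weak gradient exists.\<close>

definition weak_grad :: "(real^'n) set \<Rightarrow> (real^'n \<Rightarrow> real) \<Rightarrow> real^'n \<Rightarrow> real^'n" where
  "weak_grad \<Omega> u = (SOME g. has_weak_gradient \<Omega> u g)"

section \<open>Sobolev spaces and traces on the flat part\<close>

definition L2 :: "'a measure \<Rightarrow> ('a \<Rightarrow> 'b::real_normed_vector) set" where
  "L2 M = {f. f \<in> borel_measurable M \<and> (\<integral>\<^sup>+x. ennreal ((norm (f x))\<^sup>2) \<partial>M) < \<infinity>}"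

definition H1 :: "(real^'n) set \<Rightarrow> (real^'n \<Rightarrow> real) set" where
  "H1 \<Omega> = {u. u \<in> L2 (lebesgue_on \<Omega>) \<and> (\<exists>g. has_weak_gradient \<Omega> u g) \<and>
               weak_grad \<Omega> u \<in> L2 (lebesgue_on \<Omega>)}"

text \<open>\<open>h\<close> is the trace of \<open>u \<in> H\<^sup>1(B\<^sub>R\<^sup>+)\<close> on the flat part: the trace operator is the continuous
  extension to \<open>H\<^sup>1\<close>, with values in \<open>L\<^sup>2\<close> of the flat part, of the restriction map on functions
  smooth up to the boundary. The first two limits below are convergence in \<open>H\<^sup>1(B\<^sub>R\<^sup>+)\<close>.\<close>

definition has_flat_trace ::
    "'n::finite \<Rightarrow> real \<Rightarrow> (real^'n \<Rightarrow> real) \<Rightarrow> (real^'n \<Rightarrow> real) \<Rightarrow> bool" where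
  "has_flat_trace k R u h \<longleftrightarrow>
     h \<in> L2 (restrict_space (hyperplane_measure k) (flat_part k R)) \<and>
     (\<exists>\<phi> d\<phi>. (\<forall>m::nat. smooth (\<phi> m) \<and> (\<forall>x. GDERIV (\<phi> m) x :> d\<phi> m x)) \<and>
        (\<lambda>m. \<integral>\<^sup>+x. ennreal ((\<phi> m x - u x)\<^sup>2) \<partial>lebesgue_on (half_ball k R)) \<longlonglongrightarrow> 0 \<and>
        (\<lambda>m. \<integral>\<^sup>+x. ennreal ((norm (d\<phi> m x - weak_grad (half_ball k R) u x))\<^sup>2)
               \<partial>lebesgue_on (half_ball k R)) \<longlonglongrightarrow> 0 \<and>
        (\<lambda>m. \<integral>\<^sup>+x. ennreal ((\<phi> m x - h x)\<^sup>2)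
               \<partial>restrict_space (hyperplane_measure k) (flat_part k R)) \<longlonglongrightarrow> 0)"

definition H1_0L :: "'n::finite \<Rightarrow> real \<Rightarrow> (real^'n \<Rightarrow> real) set" where
  "H1_0L k R = {u. u \<in> H1 (half_ball k R) \<and> has_flat_trace k R u (\<lambda>_. 0)}"

section \<open>Parabolic function spaces\<close>

text \<open>Elements of the spaces \<open>L\<^sup>q((-T,0]; X)\<close> are represented by functions \<open>u x t\<close> that are
  jointly Lebesgue measurable on the cylinder. As the spaces \<open>X\<close> used here are separable
  Hilbert spaces of functions, this is the same as strong measurability of \<open>t \<mapsto> u(\<cdot>,t)\<close> with
  values in \<open>X\<close>.\<close>

definition cylinder_measurable ::
    "'n::finite \<Rightarrow> real \<Rightarrow> real \<Rightarrow> (real^'n \<Rightarrow> real \<Rightarrow> real) \<Rightarrow> bool" where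
  "cylinder_measurable k R T u \<longleftrightarrow>
     (\<lambda>(x, t). u x t) \<in> borel_measurable (lebesgue_on (half_cylinder k R T))"

text \<open>The squared norm of a function in \<open>L\<^sup>2(B\<^sub>R\<^sup>+, x\<^sub>n\<^sup>p dx)\<close>.\<close>

definition weighted_L2_sq :: "'n::finite \<Rightarrow> real \<Rightarrow> real \<Rightarrow> (real^'n \<Rightarrow> real) \<Rightarrow> ennreal" where
  "weighted_L2_sq k p R v =
     (\<integral>\<^sup>+x. ennreal ((v x)\<^sup>2 * (x $ k) powr p) \<partial>lebesgue_on (half_ball k R))"

definition grad_L2_sq :: "'n::finite \<Rightarrow> real \<Rightarrow> (real^'n \<Rightarrow> real) \<Rightarrow> ennreal" where
  "grad_L2_sq k R v =
     (\<integral>\<^sup>+x. ennreal ((norm (weak_grad (half_ball k R) v x))\<^sup>2) \<partial>lebesgue_on (half_ball k R))"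

definition H1_norm_sq :: "'n::finite \<Rightarrow> real \<Rightarrow> (real^'n \<Rightarrow> real) \<Rightarrow> ennreal" where
  "H1_norm_sq k R v =
     (\<integral>\<^sup>+x. ennreal ((v x)\<^sup>2) \<partial>lebesgue_on (half_ball k R)) + grad_L2_sq k R v"

definition Linf_weighted_L2 ::
    "'n::finite \<Rightarrow> real \<Rightarrow> real \<Rightarrow> real \<Rightarrow> (real^'n \<Rightarrow> real \<Rightarrow> real) set" where
  "Linf_weighted_L2 k p R T = {u. cylinder_measurable k R T u \<and>
     esssup (lebesgue_on {-T<..0}) (\<lambda>t. weighted_L2_sq k p R (\<lambda>x. u x t)) < \<infinity>}"

definition L2_H1_0L ::
    "'n::finite \<Rightarrow> real \<Rightarrow> real \<Rightarrow> (real^'n \<Rightarrow> real \<Rightarrow> real) set" where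
  "L2_H1_0L k R T = {u. cylinder_measurable k R T u \<and>
     (AE t in lebesgue_on {-T<..0}. (\<lambda>x. u x t) \<in> H1_0L k R) \<and>
     (\<integral>\<^sup>+t. H1_norm_sq k R (\<lambda>x. u x t) \<partial>lebesgue_on {-T<..0}) < \<infinity>}"

text \<open>The conversion \<^const>\<open>enn2real\<close> loses nothing on
  \<open>Linf_weighted_L2 k p R T \<inter> L2_H1_0L k R T\<close>, where both summands are finite.\<close>

definition V2_norm ::
    "'n::finite \<Rightarrow> real \<Rightarrow> real \<Rightarrow> real \<Rightarrow> (real^'n \<Rightarrow> real \<Rightarrow> real) \<Rightarrow> real" where
  "V2_norm k p R T u = sqrt (enn2real (
     esssup (lebesgue_on {-T<..<0}) (\<lambda>t. weighted_L2_sq k p R (\<lambda>x. u x t)) +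
     (\<integral>\<^sup>+t. grad_L2_sq k R (\<lambda>x. u x t) \<partial>lebesgue_on {-T<..0})))"

end

theory Submission
  imports Defs
begin

text \<open>Fix a time and write \<open>A = \<integral>v\<^sup>2 x\<^sub>n\<^sup>p dx\<close>. Suppose \<open>\<bar>v\<bar> \<ge> 2a\<close> on a set \<open>E\<close>, and let \<open>\<rho>\<close> be the length
  with \<open>\<rho>\<^bsup>n + p\<^esup> = K A / a\<^sup>2\<close>. Moving from \<open>x \<in> E\<close> over the distance \<open>\<rho>\<close> into the half ball, one lands
  on average at points where \<open>\<bar>v\<bar>\<close> is well below \<open>a\<close>; if \<open>\<rho>\<close> exceeds the radius, the flat part, where
  \<open>v\<close> vanishes, plays this role. Applied to a truncation of \<open>v\<close> this gives
  \<open>\<bar>E\<bar> \<le> C min(R, \<rho>)\<^sup>2 a\<^bsup>-2\<^esup> \<integral>\<bar>\<nabla>v\<bar>\<^sup>2\<close>, the integral being over \<open>a \<le> \<bar>v\<bar> \<le> 2a\<close> only. Summation over dyadic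
  levels \<open>a\<close> yields \<open>\<integral>\<bar>v\<bar>\<^bsup>2 + 2\<beta>\<^esup> \<le> C R\<^bsup>2 - 2\<theta>\<^esup> A\<^bsup>\<beta>\<^esup> \<integral>\<bar>\<nabla>v\<bar>\<^sup>2\<close> for every \<open>\<theta> \<in> [0, 1]\<close>, where
  \<open>\<beta> = 2\<theta> / (n + p)\<close>, and integration in time gives the theorem. One takes \<open>\<theta> = 1\<close> for \<open>n \<ge> 3\<close>,
  \<open>\<theta> = 1/2\<close> for \<open>n = 1\<close> and \<open>\<theta> = (p + 2) / (2p + 2)\<close> for \<open>n = 2\<close>. No Sobolev or Hardy
  inequality is needed.\<close>

section \<open>A continuously differentiable truncation\<close>

text \<open>Unlike the positive part itself, its square is continuously differentiable. Truncations
  assembled from it obey the classical chain rule, and their compositions with a smooth function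
  keep a continuous gradient.\<close>

definition sq_pos_part :: "real \<Rightarrow> real" where
  "sq_pos_part s = (max 0 s)\<^sup>2"

lemma sq_pos_part_deriv: "(sq_pos_part has_real_derivative 2 * max 0 s) (at s)"
proof -
  consider "s > 0" | "s < 0" | "s = 0" by linarith
  then show ?thesis
  proof cases
    case 1
    have "((\<lambda>x. x\<^sup>2) has_real_derivative 2 * max 0 s) (at s)"
      using 1 by (auto intro!: derivative_eq_intros)
    then show ?thesis
      by (rule has_field_derivative_transform_within_open[where S = "{0<..}"])
         (use 1 in \<open>auto simp: sq_pos_part_def\<close>)
  next
    case 2
    have "((\<lambda>x. 0) has_real_derivative 2 * max 0 s) (at s)"
      using 2 by (auto intro!: derivative_eq_intros)
    then show ?thesis
      by (rule has_field_derivative_transform_within_open[where S = "{..<0}"])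
         (use 2 in \<open>auto simp: sq_pos_part_def\<close>)
  next
    case 3
    have "((\<lambda>h. (max 0 h)\<^sup>2 / h) \<longlongrightarrow> 0) (at (0::real))"
    proof (rule Lim_null_comparison)
      show "((\<lambda>h::real. \<bar>h\<bar>) \<longlongrightarrow> 0) (at 0)"
        by (simp add: tendsto_rabs_zero)
      show "\<forall>\<^sub>F h in at (0::real). norm ((max 0 h)\<^sup>2 / h) \<le> \<bar>h\<bar>"
        by (auto simp: eventually_at_filter max_def power2_eq_square)
    qed
    then show ?thesis
      using 3 by (simp add: DERIV_def sq_pos_part_def)
  qed
qed

text \<open>On each half line this is a second difference of \<open>sq_pos_part\<close> with step
  1/2. The result is even, vanishes for |s| \<le> 1 and equals 1/2 for |s| \<ge> 2; its derivative
  on the positive axis is a tent of height 1 over [1, 2].\<close>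

definition trunc :: "real \<Rightarrow> real" where
  "trunc s = sq_pos_part (s - 1) - 2 * sq_pos_part (s - 3/2) + sq_pos_part (s - 2)
           + sq_pos_part (- s - 1) - 2 * sq_pos_part (- s - 3/2) + sq_pos_part (- s - 2)"

definition trunc' :: "real \<Rightarrow> real" where
  "trunc' s = 2 * max 0 (s - 1) - 4 * max 0 (s - 3/2) + 2 * max 0 (s - 2)
            - 2 * max 0 (- s - 1) + 4 * max 0 (- s - 3/2) - 2 * max 0 (- s - 2)"

lemma trunc_deriv: "(trunc has_real_derivative trunc' s) (at s)"
  unfolding trunc_def trunc'_def
  by (rule derivative_eq_intros DERIV_chain2[OF sq_pos_part_deriv] refl)+ (simp add: algebra_simps)

lemma continuous_on_trunc': "continuous_on UNIV trunc'"
  unfolding trunc'_def by (intro continuous_intros)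

text \<open>The tents of \<open>trunc'\<close> have height 1. The indicator on the right confines
  the energy of a truncation to one dyadic shell, and this is what lets the energies of all levels
  add up to a multiple of the full energy.\<close>

lemma abs_trunc'_le: "\<bar>trunc' s\<bar> \<le> of_bool (1 \<le> \<bar>s\<bar> \<and> \<bar>s\<bar> \<le> 2)"
  by (auto simp: trunc'_def max_def abs_if of_bool_def)

lemma trunc_top: "2 \<le> \<bar>s\<bar> \<Longrightarrow> trunc s = 1/2"
  by (auto simp: trunc_def sq_pos_part_def max_def abs_if power2_eq_square algebra_simps split: if_splits)

text \<open>For |s| \<le> 1 the truncation vanishes, elsewhere it is at most 1/2 in modulus. In the
  level estimates this bounds the truncation at a comparison point by the function itself, hence by
  the weighted norm or by the boundary values.\<close>

lemma trunc_sq_le: "(trunc s)\<^sup>2 \<le> s\<^sup>2"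
proof -
  have 0: "trunc s = 0" if "\<bar>s\<bar> \<le> 1"
    using that by (auto simp: trunc_def sq_pos_part_def max_def)
  have even: "trunc (- t) = trunc t" for t
    by (simp add: trunc_def)
  have 1: "\<bar>trunc t\<bar> \<le> 1/2" if t: "t \<ge> 1" for t
  proof -
    consider "t \<le> 3/2" | "3/2 \<le> t" "t \<le> 2" | "2 \<le> t" by linarith
    then show ?thesis
    proof cases
      case 1
      then have "trunc t = (t - 1)\<^sup>2" using t by (auto simp: trunc_def sq_pos_part_def max_def)
      moreover have "(t - 1)\<^sup>2 \<le> (1/2)\<^sup>2" using 1 t by (intro power_mono) auto
      ultimately show ?thesis by (simp add: power2_eq_square)
    next
      case 2
      then have "trunc t = (t - 1)\<^sup>2 - 2 * (t - 3/2)\<^sup>2"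
        using t by (auto simp: trunc_def sq_pos_part_def max_def)
      also have "\<dots> = 1/2 - (2 - t)\<^sup>2" by (simp add: power2_eq_square algebra_simps)
      finally have eq: "trunc t = 1/2 - (2 - t)\<^sup>2" .
      moreover have "(2 - t)\<^sup>2 \<le> (1/2)\<^sup>2" using 2 by (intro power_mono) auto
      moreover have "(2 - t)\<^sup>2 \<ge> 0" by simp
      ultimately show ?thesis by (simp add: power2_eq_square)
    next
      case 3
      then show ?thesis using trunc_top[of t] by simp
    qed
  qed
  show ?thesis
  proof (cases "\<bar>s\<bar> \<le> 1")
    case True then show ?thesis using 0 by simp
  next
    case False
    then have "\<bar>trunc s\<bar> \<le> 1/2"
      using 1[of s] 1[of "-s"] even[of s] by linarith
    then have "\<bar>trunc s\<bar> \<le> \<bar>s\<bar>" using False by linarith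
    then show ?thesis by (simp add: abs_le_square_iff)
  qed
qed

section \<open>Half balls, segments and slices\<close>

lemma half_ball_convex_comb:
  assumes "x \<in> half_ball k R" "z \<in> half_ball k R" "0 \<le> s" "s \<le> 1"
  shows "(1 - s) *\<^sub>R x + s *\<^sub>R z \<in> half_ball k R"
proof -
  have "half_ball k R = ball 0 R \<inter> {x. x \<bullet> axis k 1 > 0}"
    by (auto simp: half_ball_def inner_axis)
  then have "convex (half_ball k R)"
    using convex_halfspace_gt[of 0 "axis k (1::real)"]
    by (auto intro!: convex_Int simp: inner_commute)
  then show ?thesis using assms by (auto simp: convex_alt)
qed

lemma open_half_ball: "open (half_ball (k::'n::finite) R)"
proof -
  have "half_ball k R = ball 0 R \<inter> {x::real^'n. 0 < x $ k}" by (auto simp: half_ball_def)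
  moreover have "open {x::real^'n. 0 < x $ k}"
    using open_halfspace_component_gt_cart[of 0 k] by simp
  ultimately show ?thesis by (metis open_Int open_ball)
qed

lemma half_ball_borel [measurable]: "half_ball k R \<in> sets borel"
  by (intro borel_open open_half_ball)

lemma emeasure_half_ball_finite: "emeasure lborel (half_ball k R) < \<infinity>"
  by (rule emeasure_bounded_finite) (rule bounded_subset[of "ball 0 R"], auto simp: half_ball_def)

text \<open>Fundamental theorem of calculus along a segment, followed by Cauchy--Schwarz.\<close>

lemma segment_increment_sq_le:
  fixes w :: "real^'n \<Rightarrow> real"
  assumes d: "\<And>x. GDERIV w x :> dw x" and c: "continuous_on UNIV dw"
  shows "ennreal ((w y - w x)\<^sup>2) \<le> ennreal ((norm (y - x))\<^sup>2) *
     (\<integral>\<^sup>+s\<in>{0<..<1}. ennreal ((norm (dw (x + s *\<^sub>R (y - x))))\<^sup>2) \<partial>lborel)"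
proof -
  define f' where "f' s = (y - x) \<bullet> dw (x + s *\<^sub>R (y - x))" for s
  define N where "N s = (norm (dw (x + s *\<^sub>R (y - x))))\<^sup>2" for s
  have cdw: "continuous_on {0..1} (\<lambda>s. dw (x + s *\<^sub>R (y - x)))"
    by (rule continuous_on_compose2[OF c]) (auto intro!: continuous_intros)
  have cf': "continuous_on {0..1} f'" and cN: "continuous_on {0..1} N"
    unfolding f'_def N_def by (auto intro!: continuous_intros cdw)
  have der: "((\<lambda>s. w (x + s *\<^sub>R (y - x))) has_real_derivative f' s) (at s within {0..1})" for s
  proof -
    have "((\<lambda>s. w (x + s *\<^sub>R (y - x))) has_derivative (\<lambda>h. (h *\<^sub>R (y - x)) \<bullet> dw (x + s *\<^sub>R (y - x))))
            (at s within {0..1})"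
      by (rule has_derivative_compose[OF _ d[unfolded gderiv_def]]) (auto intro!: derivative_eq_intros)
    then show ?thesis
      by (simp add: has_field_derivative_def f'_def mult_commute_abs)
  qed
  have I: "(f' has_integral w y - w x) {0..1}"
    using fundamental_theorem_of_calculus[of 0 1 "\<lambda>s. w (x + s *\<^sub>R (y - x))" f'] der
    by (simp add: has_real_derivative_iff_has_vector_derivative)
  define D where "D = w y - w x"
  have Nint: "N integrable_on {0..1}" by (rule integrable_continuous_real[OF cN])
  have f2: "(\<lambda>s. (f' s)\<^sup>2) integrable_on {0..1}"
    by (intro integrable_continuous_real continuous_intros cf')
  \<comment> \<open>Cauchy-Schwarz by way of the mean value \<open>D\<close> of \<open>f'\<close>
    over [0, 1]: the integral of the nonnegative function \<open>(f' s - D)\<^sup>2\<close> is the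
    integral of \<open>(f' s)\<^sup>2\<close> minus \<open>D\<^sup>2\<close>.\<close>
  have "((\<lambda>s. (f' s)\<^sup>2 - 2 * D * f' s + D\<^sup>2) has_integral
      (integral {0..1} (\<lambda>s. (f' s)\<^sup>2) - 2 * D * D + D\<^sup>2)) {0..1}"
    using has_integral_const_real[of "D\<^sup>2" 0 1]
    by (intro has_integral_add has_integral_diff has_integral_mult_right integrable_integral f2
        I[folded D_def]) auto
  then have "0 \<le> integral {0..1} (\<lambda>s. (f' s)\<^sup>2) - 2 * D * D + D\<^sup>2"
  proof (rule has_integral_nonneg)
    fix s
    have "(f' s)\<^sup>2 - 2 * D * f' s + D\<^sup>2 = (f' s - D)\<^sup>2"
      by (simp add: power2_eq_square algebra_simps)
    then show "0 \<le> (f' s)\<^sup>2 - 2 * D * f' s + D\<^sup>2" by simp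
  qed
  then have "D\<^sup>2 \<le> integral {0..1} (\<lambda>s. (f' s)\<^sup>2)" by (simp add: power2_eq_square)
  also have "\<dots> \<le> integral {0..1} (\<lambda>s. (norm (y - x))\<^sup>2 * N s)"
  proof (intro integral_le f2 integrable_on_mult_right Nint)
    fix s
    have "\<bar>f' s\<bar> \<le> norm (y - x) * norm (dw (x + s *\<^sub>R (y - x)))"
      unfolding f'_def by (rule Cauchy_Schwarz_ineq2)
    then have "\<bar>f' s\<bar>\<^sup>2 \<le> (norm (y - x) * norm (dw (x + s *\<^sub>R (y - x))))\<^sup>2"
      by (intro power_mono) auto
    then show "(f' s)\<^sup>2 \<le> (norm (y - x))\<^sup>2 * N s" by (simp add: N_def power_mult_distrib)
  qed
  finally have "D\<^sup>2 \<le> (norm (y - x))\<^sup>2 * integral {0..1} N" by simp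
  \<comment> \<open>The end points form a null set. Omitting them matters in the boundary estimate,
    where the segment ends on the flat part and so outside the half ball.\<close>
  moreover have "(\<integral>\<^sup>+s\<in>{0<..<1}. ennreal (N s) \<partial>lborel) = ennreal (integral {0..1} N)"
  proof -
    have "AE s in lborel. (s::real) \<noteq> 0 \<and> s \<noteq> 1"
      using AE_lborel_singleton[of "0::real"] AE_lborel_singleton[of "1::real"] by auto
    then have "(\<integral>\<^sup>+s\<in>{0<..<1}. ennreal (N s) \<partial>lborel) = (\<integral>\<^sup>+s\<in>{0..1}. ennreal (N s) \<partial>lborel)"
      by (intro nn_integral_cong_AE, elim eventually_mono) (auto simp: indicator_def)
    moreover have "(\<integral>\<^sup>+s. ennreal (indicator {0..1} s * N s) \<partial>lborel) = ennreal (integral {0..1} N)"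
    proof (rule nn_integral_has_integral_lborel)
      show "(\<lambda>s. indicator {0..1} s * N s) \<in> borel_measurable borel"
        using borel_measurable_continuous_on_indicator[OF _ cN] by simp
      show "0 \<le> indicator {0..1} s * N s" for s :: real by (simp add: N_def)
      have "(N has_integral integral {0..1} N) {0..1}" by (rule integrable_integral[OF Nint])
      then show "((\<lambda>s. indicator {0..1} s * N s) has_integral integral {0..1} N) UNIV"
        by (subst (asm) has_integral_restrict_UNIV[symmetric])
           (auto elim!: has_integral_eq[rotated] simp: indicator_def)
    qed
    moreover have "ennreal (N s) * indicator {0..1} s = ennreal (indicator {0..1} s * N s)" for s
      by (auto simp: indicator_def)
    ultimately show ?thesis by simp
  qed
  ultimately show ?thesis
    by (simp add: D_def N_def ennreal_mult'[symmetric] ennreal_leI)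
qed

text \<open>It serves each of the two variables of a comparison point
  \<open>(1 - s) *\<^sub>R x + s *\<^sub>R z\<close>, and in dimension one the parameter of a
  segment that runs down to the flat part.\<close>

lemma nn_integral_lborel_affine:
  fixes f :: "'a::euclidean_space \<Rightarrow> ennreal"
  assumes [measurable]: "f \<in> borel_measurable borel" and "c > 0"
  shows "(\<integral>\<^sup>+x. f (t + c *\<^sub>R x) \<partial>lborel) = ennreal ((1 / c) ^ DIM('a)) * (\<integral>\<^sup>+x. f x \<partial>lborel)"
proof -
  have "(\<integral>\<^sup>+x. f x \<partial>lborel) = (\<integral>\<^sup>+x. f x \<partial>density (distr lborel borel (\<lambda>x. t + c *\<^sub>R x)) (\<lambda>_. \<bar>c\<bar>^DIM('a)))"
    using lborel_affine[of c t] assms by simp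
  also have "\<dots> = ennreal (c ^ DIM('a)) * (\<integral>\<^sup>+x. f (t + c *\<^sub>R x) \<partial>lborel)"
    using \<open>c > 0\<close> by (simp add: nn_integral_density nn_integral_distr nn_integral_cmult)
  finally show ?thesis
    using \<open>c > 0\<close>
    by (simp add: mult.assoc[symmetric] ennreal_mult'[symmetric] power_mult_distrib[symmetric])
qed

text \<open>Both measures give a box the product of its side lengths. In product form one coordinate
  can be split off, leaving the product over \<open>UNIV - {k}\<close> from which
  \<open>hyperplane_measure\<close> is built.\<close>

lemma lborel_vec_eq_PiM:
  "(lborel :: (real^'n::finite) measure) = distr (Pi\<^sub>M UNIV (\<lambda>_. lborel)) borel (\<lambda>f. \<chi> i. f i)"
proof (rule lborel_eqI)
  interpret product_sigma_finite "\<lambda>_::'n. lborel :: real measure" ..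
  have m: "(\<lambda>f. (\<chi> i. f i) :: real^'n) \<in> Pi\<^sub>M UNIV (\<lambda>_. lborel) \<rightarrow>\<^sub>M borel"
    by (subst borel_measurable_euclidean_space)
      (auto simp: Basis_vec_def inner_axis intro!: measurable_component_singleton)
  fix l u :: "real^'n" assume le: "\<And>b. b \<in> Basis \<Longrightarrow> l \<bullet> b \<le> u \<bullet> b"
  then have le': "l $ i \<le> u $ i" for i
    using le[of "axis i 1"] by (auto simp: Basis_vec_def inner_axis)
  have "(\<lambda>f. (\<chi> i. f i) :: real^'n) -` box l u \<inter> space (Pi\<^sub>M UNIV (\<lambda>_. lborel)) = Pi\<^sub>E UNIV (\<lambda>i. {l $ i<..<u $ i})"
    by (auto simp: mem_box_cart space_PiM PiE_def extensional_def Pi_def)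
  then have "emeasure (distr (Pi\<^sub>M UNIV (\<lambda>_. lborel)) borel (\<lambda>f. \<chi> i. f i)) (box l u) = (\<Prod>i\<in>UNIV. ennreal (u $ i - l $ i))"
    using le' by (simp add: emeasure_distr[OF m] emeasure_PiM)
  also have "\<dots> = ennreal (\<Prod>i\<in>UNIV. u $ i - l $ i)" using le' by (simp add: prod_ennreal)
  also have "(\<Prod>i\<in>UNIV. u $ i - l $ i) = (\<Prod>b\<in>Basis. (u - l) \<bullet> b)"
    by (simp add: Basis_vec_def UNION_singleton_eq_range prod.reindex inj_on_def axis_eq_axis inner_axis)
  finally show "emeasure (distr (Pi\<^sub>M UNIV (\<lambda>_. lborel)) borel (\<lambda>f. \<chi> i. f i)) (box l u) = ennreal (\<Prod>b\<in>Basis. (u - l) \<bullet> b)" .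
qed simp

text \<open>Fubini along the lines parallel to the axis \<open>k\<close>. Setting the coordinate
  \<open>k\<close> to zero does not increase the norm, so a line that meets the half ball also meets
  the flat part, and it stays in the half ball for a length of at most \<open>R\<close>.\<close>

lemma nn_integral_half_ball_trace_le:
  fixes h :: "real^'n::finite \<Rightarrow> ennreal"
  assumes [measurable]: "h \<in> borel_measurable borel" and R: "R > 0"
  shows "(\<integral>\<^sup>+x\<in>half_ball k R. h (\<chi> i. if i = k then 0 else x $ i) \<partial>lborel)
    \<le> ennreal R * (\<integral>\<^sup>+x. h x \<partial>restrict_space (hyperplane_measure k) (flat_part k R))"
proof -
  interpret product_sigma_finite "\<lambda>_::'n. lborel :: real measure" ..
  have m: "(\<lambda>f. (\<chi> i. f i) :: real^'n) \<in> Pi\<^sub>M UNIV (\<lambda>_. lborel) \<rightarrow>\<^sub>M borel"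
    by (subst borel_measurable_euclidean_space)
      (auto simp: Basis_vec_def inner_axis intro!: measurable_component_singleton)
  have m0: "(\<lambda>x::real^'n. \<chi> i. if i = k then 0 else x $ i) \<in> borel \<rightarrow>\<^sub>M borel"
  proof (intro borel_measurable_continuous_onI continuous_on_vec_lambda)
    show "continuous_on UNIV (\<lambda>x::real^'n. if i = k then 0 else x $ i)" for i
      by (cases "i = k") (auto intro!: continuous_intros)
  qed
  note [measurable] = m m0 hyperplane_measure_map_measurable
  have flat: "flat_part k R \<in> sets borel"
  proof -
    have "flat_part k R = ball 0 R \<inter> {x. x $ k = 0}" by (auto simp: flat_part_def)
    moreover have "closed {x::real^'n. x $ k = 0}" by (intro closed_Collect_eq continuous_intros)
    ultimately show ?thesis by (metis borel_closed borel_open open_ball sets.Int)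
  qed
  note [measurable] = flat
  let ?P = "\<lambda>y::'n \<Rightarrow> real. (\<chi> i. if i = k then 0 else y i) :: real^'n"
  let ?F = "\<lambda>x. h (\<chi> i. if i = k then 0 else x $ i) * indicator (half_ball k R) x"
  have [measurable]: "?F \<in> borel_measurable borel" by measurable
  have UN: "insert k (UNIV - {k}) = UNIV" by auto
  have "(\<integral>\<^sup>+x. ?F x \<partial>lborel) = (\<integral>\<^sup>+f. ?F (\<chi> i. f i) \<partial>Pi\<^sub>M UNIV (\<lambda>_. lborel))"
    by (subst lborel_vec_eq_PiM, subst nn_integral_distr) auto
  also have "\<dots> = (\<integral>\<^sup>+y. (\<integral>\<^sup>+s. ?F (\<chi> i. (y(k := s)) i) \<partial>lborel) \<partial>Pi\<^sub>M (UNIV - {k}) (\<lambda>_. lborel))"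
    using product_nn_integral_insert[of "UNIV - {k}" k "\<lambda>f. ?F (\<chi> i. f i)"] UN by simp
  also have "\<dots> \<le> (\<integral>\<^sup>+y. (\<integral>\<^sup>+s. (h (?P y) * indicator (flat_part k R) (?P y)) * indicator {0..R} s \<partial>lborel)
        \<partial>Pi\<^sub>M (UNIV - {k}) (\<lambda>_. lborel))"
  proof (intro nn_integral_mono)
    fix y :: "'n \<Rightarrow> real" and s :: real
    let ?x = "(\<chi> i. (y(k := s)) i) :: real^'n"
    have eq: "(\<chi> i. if i = k then 0 else ?x $ i) = ?P y" by (auto simp: vec_eq_iff)
    have "?P y \<in> flat_part k R \<and> s \<in> {0..R}" if x: "?x \<in> half_ball k R"
    proof -
      have "norm (?P y) \<le> norm ?x"
        by (rule norm_le_componentwise_cart) auto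
      moreover have "\<bar>?x $ k\<bar> \<le> norm ?x" by (rule component_le_norm_cart)
      ultimately show ?thesis using x by (auto simp: half_ball_def flat_part_def)
    qed
    then show "?F ?x \<le> h (?P y) * indicator (flat_part k R) (?P y) * indicator {0..R} s"
      unfolding eq by (auto simp: indicator_def)
  qed
  also have "\<dots> = (\<integral>\<^sup>+y. ennreal R * (h (?P y) * indicator (flat_part k R) (?P y)) \<partial>Pi\<^sub>M (UNIV - {k}) (\<lambda>_. lborel))"
    using R by (intro nn_integral_cong, subst nn_integral_cmult_indicator) (auto simp: mult.commute)
  also have "\<dots> = ennreal R * (\<integral>\<^sup>+y. (h (?P y) * indicator (flat_part k R) (?P y)) \<partial>Pi\<^sub>M (UNIV - {k}) (\<lambda>_. lborel))"
    by (rule nn_integral_cmult) measurable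
  also have "(\<integral>\<^sup>+y. (h (?P y) * indicator (flat_part k R) (?P y)) \<partial>Pi\<^sub>M (UNIV - {k}) (\<lambda>_. lborel))
     = (\<integral>\<^sup>+x. h x * indicator (flat_part k R) x \<partial>hyperplane_measure k)"
    unfolding hyperplane_measure_def by (subst nn_integral_distr) auto
  also have "\<dots> = (\<integral>\<^sup>+x. h x \<partial>restrict_space (hyperplane_measure k) (flat_part k R))"
    by (subst nn_integral_restrict_space) (auto simp: hyperplane_measure_def)
  finally show ?thesis .
qed

section \<open>Estimates on a single level\<close>

lemma nn_integral_lebesgue_on_half_ball:
  "(\<integral>\<^sup>+x. f x \<partial>lebesgue_on (half_ball k R)) = (\<integral>\<^sup>+x\<in>half_ball k R. f x \<partial>lborel)"
  by (subst nn_integral_restrict_space) (auto simp: nn_integral_completion)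

lemma C1_continuous:
  assumes "\<And>x. GDERIV \<phi> x :> d\<phi> x"
  shows "continuous_on UNIV \<phi>"
  using assms unfolding gderiv_def
  by (meson continuous_at_imp_continuous_on has_derivative_continuous)

text \<open>The field \<open>g\<close> is a separate argument because the classical gradients of
  smooth approximations and the weak gradient of their limit both occur in its place. The shell is
  closed, so values off the shell stay off it under small perturbations.\<close>

definition level_energy :: "'n::finite \<Rightarrow> real \<Rightarrow> real \<Rightarrow> (real^'n \<Rightarrow> real) \<Rightarrow> (real^'n \<Rightarrow> real^'n) \<Rightarrow> ennreal" where
  "level_energy k R a v g = (\<integral>\<^sup>+x. ennreal (of_bool (a \<le> \<bar>v x\<bar> \<and> \<bar>v x\<bar> \<le> 2 * a) * (norm (g x))\<^sup>2)
     \<partial>lebesgue_on (half_ball k R))"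

lemma trunc_gderiv:
  assumes "GDERIV \<phi> x :> d" "a > 0"
  shows "GDERIV (\<lambda>x. trunc (\<phi> x / a)) x :> (trunc' (\<phi> x / a) / a) *\<^sub>R d"
proof -
  have "((\<lambda>s. trunc (s / a)) has_real_derivative trunc' (\<phi> x / a) / a) (at (\<phi> x))"
    using DERIV_chain2[OF trunc_deriv DERIV_cdivide[OF DERIV_ident]] by simp
  from GDERIV_DERIV_compose[OF assms(1) this] show ?thesis .
qed

lemma trunc_gradient_sq_le:
  assumes "a > 0"
  shows "(norm ((trunc' (s / a) / a) *\<^sub>R d))\<^sup>2 \<le> (1 / a\<^sup>2) * (of_bool (a \<le> \<bar>s\<bar> \<and> \<bar>s\<bar> \<le> 2 * a) * (norm d)\<^sup>2)"
proof -
  have "\<bar>trunc' (s / a)\<bar> \<le> of_bool (a \<le> \<bar>s\<bar> \<and> \<bar>s\<bar> \<le> 2 * a)"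
    using abs_trunc'_le[of "s / a"] assms by (simp add: field_simps)
  then have "\<bar>trunc' (s / a)\<bar>\<^sup>2 \<le> (of_bool (a \<le> \<bar>s\<bar> \<and> \<bar>s\<bar> \<le> 2 * a))\<^sup>2"
    by (rule power_mono) simp
  then have "(trunc' (s / a))\<^sup>2 \<le> of_bool (a \<le> \<bar>s\<bar> \<and> \<bar>s\<bar> \<le> 2 * a)"
    by (simp add: of_bool_def split: if_splits)
  then have "(trunc' (s / a))\<^sup>2 * ((norm d)\<^sup>2 / a\<^sup>2) \<le> of_bool (a \<le> \<bar>s\<bar> \<and> \<bar>s\<bar> \<le> 2 * a) * ((norm d)\<^sup>2 / a\<^sup>2)"
    by (rule mult_right_mono) simp
  then show ?thesis by (simp add: power_mult_distrib power_divide)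
qed

lemma truncated_energy_le:
  assumes "a > 0" and d: "\<And>x. GDERIV \<phi> x :> d\<phi> x" and c: "continuous_on UNIV d\<phi>"
  shows "(\<integral>\<^sup>+x\<in>half_ball k R. ennreal ((norm ((trunc' (\<phi> x / a) / a) *\<^sub>R d\<phi> x))\<^sup>2) \<partial>lborel)
     \<le> ennreal (1 / a\<^sup>2) * level_energy k R a \<phi> d\<phi>"
proof -
  have [measurable]: "\<phi> \<in> borel_measurable borel" "d\<phi> \<in> borel_measurable borel"
    using C1_continuous[OF d] c by (auto intro: borel_measurable_continuous_onI)
  have "(\<integral>\<^sup>+x\<in>half_ball k R. ennreal ((norm ((trunc' (\<phi> x / a) / a) *\<^sub>R d\<phi> x))\<^sup>2) \<partial>lborel)
     \<le> (\<integral>\<^sup>+x. ennreal (1 / a\<^sup>2) * (ennreal (of_bool (a \<le> \<bar>\<phi> x\<bar> \<and> \<bar>\<phi> x\<bar> \<le> 2 * a) * (norm (d\<phi> x))\<^sup>2)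
          * indicator (half_ball k R) x) \<partial>lborel)"
  proof (intro nn_integral_mono)
    fix x
    have "ennreal ((norm ((trunc' (\<phi> x / a) / a) *\<^sub>R d\<phi> x))\<^sup>2)
        \<le> ennreal ((1 / a\<^sup>2) * (of_bool (a \<le> \<bar>\<phi> x\<bar> \<and> \<bar>\<phi> x\<bar> \<le> 2 * a) * (norm (d\<phi> x))\<^sup>2))"
      by (intro ennreal_leI trunc_gradient_sq_le assms)
    also have "\<dots> = ennreal (1 / a\<^sup>2) * ennreal (of_bool (a \<le> \<bar>\<phi> x\<bar> \<and> \<bar>\<phi> x\<bar> \<le> 2 * a) * (norm (d\<phi> x))\<^sup>2)"
      by (rule ennreal_mult) auto
    finally show "ennreal ((norm ((trunc' (\<phi> x / a) / a) *\<^sub>R d\<phi> x))\<^sup>2) * indicator (half_ball k R) x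
      \<le> ennreal (1 / a\<^sup>2) * (ennreal (of_bool (a \<le> \<bar>\<phi> x\<bar> \<and> \<bar>\<phi> x\<bar> \<le> 2 * a) * (norm (d\<phi> x))\<^sup>2)
          * indicator (half_ball k R) x)"
      by (simp only: mult.assoc[symmetric] mult_right_mono zero_le)
  qed
  also have "\<dots> = ennreal (1 / a\<^sup>2) * level_energy k R a \<phi> d\<phi>"
    unfolding level_energy_def nn_integral_lebesgue_on_half_ball
    by (rule nn_integral_cmult) measurable
  finally show ?thesis .
qed

text \<open>For levels below the scale of the half ball, the values at \<open>x\<close> are compared with those at
  \<open>(1 - s) x + s z\<close>, \<open>z\<close> ranging over a fixed ball inside the half ball. By convexity the segments
  stay inside, and the \<open>k\<close>-th coordinate of these points is bounded below, which controls the weight.\<close>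

lemma level_estimate_interior:
  fixes \<phi> :: "real^'n::finite \<Rightarrow> real"
  assumes d: "\<And>x. GDERIV \<phi> x :> d\<phi> x" and c: "continuous_on UNIV d\<phi>"
    and pos: "R > 0" "a > 0" "p \<ge> 0" "0 < s" "s \<le> 1/2" "A \<ge> 0"
    and A: "weighted_L2_sq k p R \<phi> \<le> ennreal A"
    and cond: "2 * ((1 / s) ^ CARD('n) * (s * R / 4) powr (- p) / a\<^sup>2 * A)
                 \<le> unit_ball_vol (real CARD('n)) * (R / 4) ^ CARD('n) / 8"
  shows "emeasure lborel {x \<in> half_ball k R. 2 * a \<le> \<bar>\<phi> x\<bar>}
     \<le> ennreal (64 * 2 ^ CARD('n) * (s * R)\<^sup>2 / a\<^sup>2) * level_energy k R a \<phi> d\<phi>"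
proof -
  have [measurable]: "\<phi> \<in> borel_measurable borel" "d\<phi> \<in> borel_measurable borel"
      "trunc' \<in> borel_measurable borel" "trunc \<in> borel_measurable borel"
    using C1_continuous[OF d] c continuous_on_trunc' trunc_deriv
    by (auto intro!: borel_measurable_continuous_onI continuous_at_imp_continuous_on DERIV_isCont)
  let ?n = "CARD('n)"
  let ?\<Omega> = "half_ball k R"
  define w where "w = (\<lambda>x. trunc (\<phi> x / a))"
  define dw where "dw = (\<lambda>x. (trunc' (\<phi> x / a) / a) *\<^sub>R d\<phi> x)"
  define G where "G = level_energy k R a \<phi> d\<phi>"
  define E where "E = {x \<in> ?\<Omega>. 2 * a \<le> \<bar>\<phi> x\<bar>}"
  \<comment> \<open>A fixed set of target points: the centre has height R/2 and the radius is R/4,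
    so all its points have norm below 3R/4 and height above R/4.\<close>
  define Z where "Z = ball ((R / 2) *\<^sub>R axis k 1 :: real^'n) (R / 4)"
  define g where "g = (\<lambda>x. ennreal ((norm (dw x))\<^sup>2) * indicator ?\<Omega> x)"
  have [measurable]: "w \<in> borel_measurable borel" "dw \<in> borel_measurable borel"
      "E \<in> sets borel" "Z \<in> sets borel"
    unfolding w_def dw_def E_def Z_def by measurable
  have [measurable]: "g \<in> borel_measurable borel" unfolding g_def by measurable
  have Z: "z \<in> ?\<Omega> \<and> R / 4 \<le> z $ k" if "z \<in> Z" for z
  proof -
    let ?c = "(R / 2) *\<^sub>R axis k 1 :: real^'n"
    have n: "norm (z - ?c) < R / 4" using that by (simp add: Z_def dist_norm norm_minus_commute)
    have "\<bar>(z - ?c) $ k\<bar> < R / 4" using component_le_norm_cart[of "z - ?c" k] n by linarith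
    moreover have "norm z \<le> norm (z - ?c) + norm ?c" using norm_triangle_sub[of z ?c] by linarith
    ultimately show ?thesis using n pos by (auto simp: half_ball_def abs_if split: if_splits)
  qed
  have Zvol: "emeasure lborel Z = ennreal (unit_ball_vol ?n * (R / 4) ^ ?n)"
    unfolding Z_def using pos by (subst emeasure_ball) (auto simp: DIM_cart)
  have gint: "(\<integral>\<^sup>+x. g x \<partial>lborel) \<le> ennreal (1 / a\<^sup>2) * G"
    using truncated_energy_le[OF \<open>a > 0\<close> d c] by (simp add: g_def dw_def G_def)
  have cdw: "continuous_on UNIV dw"
    unfolding dw_def using pos
    by (intro continuous_intros continuous_on_compose2[OF continuous_on_trunc'] c C1_continuous[OF d]) auto
  \<comment> \<open>\<open>F\<close> dominates the squared truncation at the comparison points.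
    Their height is at least \<open>s * R / 4\<close>, so the factor
    \<open>(s * R / 4) powr (- p)\<close> makes up for a small weight.\<close>
  define F where "F = (\<lambda>y. ennreal ((s * R / 4) powr (- p) / a\<^sup>2) * (ennreal ((\<phi> y)\<^sup>2 * (y $ k) powr p) * indicator ?\<Omega> y))"
  have [measurable]: "F \<in> borel_measurable borel" unfolding F_def by measurable
  have Fint: "(\<integral>\<^sup>+y. F y \<partial>lborel) \<le> ennreal ((s * R / 4) powr (- p) / a\<^sup>2 * A)"
  proof -
    have "(\<integral>\<^sup>+y. F y \<partial>lborel) = ennreal ((s * R / 4) powr (- p) / a\<^sup>2) * weighted_L2_sq k p R \<phi>"
      unfolding F_def weighted_L2_sq_def nn_integral_lebesgue_on_half_ball
      by (rule nn_integral_cmult) measurable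
    also have "\<dots> \<le> ennreal ((s * R / 4) powr (- p) / a\<^sup>2) * ennreal A"
      by (rule mult_left_mono[OF A]) simp
    finally show ?thesis by (simp add: ennreal_mult'[symmetric] pos)
  qed
  \<comment> \<open>On \<open>E\<close> the truncation is 1/2 in \<open>x\<close>. Its square 1/4 is
    at most twice the square at the comparison point plus twice the squared increment; the two
    points are at most 2 s R apart, which gives the factor 8. The \<open>F\<close> term keeps no
    cutoff in \<open>z\<close>.\<close>
  have pt: "ennreal (1/4) * (indicator E x * indicator Z z)
      \<le> ennreal 2 * (F ((1 - s) *\<^sub>R x + s *\<^sub>R z) * indicator E x)
       + ennreal (8 * (s * R)\<^sup>2) * (\<integral>\<^sup>+\<tau>. g ((\<tau> * s) *\<^sub>R z + (1 - \<tau> * s) *\<^sub>R x) * (indicator Z z * indicator {0<..<1} \<tau>) \<partial>lborel)"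
    for x z
  proof (cases "x \<in> E \<and> z \<in> Z")
    case True
    define y where "y = (1 - s) *\<^sub>R x + s *\<^sub>R z"
    have x: "x \<in> ?\<Omega>" "2 * a \<le> \<bar>\<phi> x\<bar>" and z: "z \<in> ?\<Omega>" "R / 4 \<le> z $ k"
      using True Z by (auto simp: E_def)
    have yx: "y - x = s *\<^sub>R (z - x)" by (simp add: y_def algebra_simps)
    have y: "y \<in> ?\<Omega>" unfolding y_def by (intro half_ball_convex_comb x z) (use pos in auto)
    have yk: "s * R / 4 \<le> y $ k"
    proof -
      have "s * (R / 4) \<le> s * z $ k" using z pos by (intro mult_left_mono) auto
      moreover have "0 \<le> (1 - s) * x $ k" using x pos by (auto simp: half_ball_def)
      ultimately show ?thesis by (simp add: y_def)
    qed
    have "norm (z - x) \<le> 2 * R" using norm_triangle_ineq4[of z x] x z by (auto simp: half_ball_def)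
    then have nyx: "norm (y - x) \<le> s * (2 * R)" using pos by (auto simp: yx)
    have "w x = 1/2" using trunc_top[of "\<phi> x / a"] x pos by (auto simp: w_def field_simps)
    then have "1/4 = (w x)\<^sup>2" by (simp only:) (simp add: power2_eq_square)
    also have "\<dots> \<le> 2 * (w y)\<^sup>2 + 2 * (w y - w x)\<^sup>2"
      using zero_le_power2[of "2 * w y - w x"] by (simp add: power2_eq_square algebra_simps)
    finally have "ennreal (1/4) \<le> ennreal (2 * (w y)\<^sup>2 + 2 * (w y - w x)\<^sup>2)" by (rule ennreal_leI)
    also have "\<dots> = ennreal 2 * ennreal ((w y)\<^sup>2) + ennreal 2 * ennreal ((w y - w x)\<^sup>2)"
      by (subst ennreal_plus) (auto simp: ennreal_mult')
    also have "ennreal ((w y)\<^sup>2) \<le> F y"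
    proof -
      have "(w y)\<^sup>2 \<le> (\<phi> y / a)\<^sup>2" unfolding w_def by (rule trunc_sq_le)
      also have "\<dots> = (\<phi> y)\<^sup>2 / a\<^sup>2 * 1" by (simp add: power_divide)
      also have "\<dots> \<le> (\<phi> y)\<^sup>2 / a\<^sup>2 * ((s * R / 4) powr (- p) * (y $ k) powr p)"
      proof (rule mult_left_mono)
        have "(s * R / 4) powr p \<le> (y $ k) powr p" using pos yk by (intro powr_mono2) auto
        then show "1 \<le> (s * R / 4) powr (- p) * (y $ k) powr p"
          using pos by (simp add: powr_minus field_simps)
      qed simp
      finally show ?thesis using y pos by (auto simp: F_def ennreal_mult'[symmetric] field_simps intro!: ennreal_leI)
    qed
    also have "ennreal ((w y - w x)\<^sup>2) \<le> ennreal ((norm (y - x))\<^sup>2) *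
        (\<integral>\<^sup>+\<tau>\<in>{0<..<1}. ennreal ((norm (dw (x + \<tau> *\<^sub>R (y - x))))\<^sup>2) \<partial>lborel)"
      using trunc_gderiv[OF d \<open>a > 0\<close>] cdw
      by (intro segment_increment_sq_le) (auto simp: w_def dw_def)
    also have "\<dots> \<le> ennreal ((s * (2 * R))\<^sup>2) * (\<integral>\<^sup>+\<tau>. g ((\<tau> * s) *\<^sub>R z + (1 - \<tau> * s) *\<^sub>R x) * (indicator Z z * indicator {0<..<1} \<tau>) \<partial>lborel)"
    proof (rule mult_mono[OF ennreal_leI[OF power_mono[OF nyx]] nn_integral_mono])
      fix \<tau> :: real
      have eq: "x + \<tau> *\<^sub>R (y - x) = (1 - \<tau> * s) *\<^sub>R x + (\<tau> * s) *\<^sub>R z" by (simp add: yx algebra_simps)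
      have "(1 - \<tau> * s) *\<^sub>R x + (\<tau> * s) *\<^sub>R z \<in> ?\<Omega>" if "0 < \<tau>" "\<tau> < 1"
        using that x z pos by (intro half_ball_convex_comb) (auto intro: mult_le_one)
      then show "ennreal ((norm (dw (x + \<tau> *\<^sub>R (y - x))))\<^sup>2) * indicator {0<..<1} \<tau>
         \<le> g ((\<tau> * s) *\<^sub>R z + (1 - \<tau> * s) *\<^sub>R x) * (indicator Z z * indicator {0<..<1} \<tau>)"
        unfolding eq using True by (auto simp: g_def indicator_def add.commute)
    qed auto
    finally have "ennreal (1/4) \<le> ennreal 2 * F y + ennreal 2 * (ennreal ((s * (2 * R))\<^sup>2) *
       (\<integral>\<^sup>+\<tau>. g ((\<tau> * s) *\<^sub>R z + (1 - \<tau> * s) *\<^sub>R x) * (indicator Z z * indicator {0<..<1} \<tau>) \<partial>lborel))"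
      by (simp add: add_mono mult_left_mono)
    also have "ennreal 2 * (ennreal ((s * (2 * R))\<^sup>2) * I) = ennreal (8 * (s * R)\<^sup>2) * I" for I
      by (subst mult.assoc[symmetric], subst ennreal_mult[symmetric]) (auto simp: power_mult_distrib)
    finally show ?thesis using True by (simp add: y_def)
  qed auto
  have Efin: "emeasure lborel E < \<infinity>"
    using emeasure_half_ball_finite[of k R] emeasure_mono[of E ?\<Omega> lborel]
    by (auto simp: E_def intro: le_less_trans)
  \<comment> \<open>For fixed \<open>z\<close> and \<open>\<tau>\<close> the substitution is made in
    \<open>x\<close>, whose coefficient 1 - \<tau> s is at least 1/2, so that the Jacobian is at
    most 2^n. The coefficient \<tau> s of \<open>z\<close> can be arbitrarily small.\<close>
  have inner: "(\<integral>\<^sup>+x. g ((\<tau> * s) *\<^sub>R z + (1 - \<tau> * s) *\<^sub>R x) * (indicator Z z * indicator {0<..<1} \<tau>) \<partial>lborel)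
      \<le> (ennreal (2 ^ ?n) * (\<integral>\<^sup>+y. g y \<partial>lborel)) * (indicator Z z * indicator {0<..<1} \<tau>)" for z \<tau>
    proof (cases "0 < \<tau> \<and> \<tau> < 1")
      case True
      have "\<tau> * s \<le> 1 * s" using True pos by (intro mult_right_mono) auto
      then have h: "1 / 2 \<le> 1 - \<tau> * s" using pos by linarith
      have "(\<integral>\<^sup>+x. g ((\<tau> * s) *\<^sub>R z + (1 - \<tau> * s) *\<^sub>R x) \<partial>lborel) = ennreal ((1 / (1 - \<tau> * s)) ^ ?n) * (\<integral>\<^sup>+y. g y \<partial>lborel)"
        using h by (subst nn_integral_lborel_affine) (auto simp: DIM_cart)
      also have "\<dots> \<le> ennreal (2 ^ ?n) * (\<integral>\<^sup>+y. g y \<partial>lborel)"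
        using h by (intro mult_right_mono ennreal_leI power_mono) (auto simp: field_simps)
      finally show ?thesis by (subst nn_integral_multc) (auto intro!: mult_right_mono)
    qed simp
  have "ennreal (1/4) * (emeasure lborel E * emeasure lborel Z)
      = (\<integral>\<^sup>+x. \<integral>\<^sup>+z. ennreal (1/4) * (indicator E x * indicator Z z) \<partial>lborel \<partial>lborel)"
    by (simp add: nn_integral_cmult nn_integral_multc mult.assoc)
  also have "\<dots> \<le> (\<integral>\<^sup>+x. \<integral>\<^sup>+z. (ennreal 2 * (F ((1 - s) *\<^sub>R x + s *\<^sub>R z) * indicator E x)
       + ennreal (8 * (s * R)\<^sup>2) * (\<integral>\<^sup>+\<tau>. g ((\<tau> * s) *\<^sub>R z + (1 - \<tau> * s) *\<^sub>R x) * (indicator Z z * indicator {0<..<1} \<tau>) \<partial>lborel)) \<partial>lborel \<partial>lborel)"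
    by (intro nn_integral_mono pt)
  also have "\<dots> = ennreal 2 * (\<integral>\<^sup>+x. (\<integral>\<^sup>+z. F ((1 - s) *\<^sub>R x + s *\<^sub>R z) \<partial>lborel) * indicator E x \<partial>lborel)
     + ennreal (8 * (s * R)\<^sup>2) * (\<integral>\<^sup>+x. \<integral>\<^sup>+z. \<integral>\<^sup>+\<tau>. g ((\<tau> * s) *\<^sub>R z + (1 - \<tau> * s) *\<^sub>R x) * (indicator Z z * indicator {0<..<1} \<tau>) \<partial>lborel \<partial>lborel \<partial>lborel)"
    by (simp add: nn_integral_add nn_integral_cmult nn_integral_multc)
  \<comment> \<open>The \<open>F\<close> term is instead integrated in \<open>z\<close> over the
    whole space, for fixed \<open>x\<close>, with Jacobian \<open>(1 / s) ^ ?n\<close>. The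
    hypothesis \<open>cond\<close> is made to absorb this factor.\<close>
  also have "(\<integral>\<^sup>+x. (\<integral>\<^sup>+z. F ((1 - s) *\<^sub>R x + s *\<^sub>R z) \<partial>lborel) * indicator E x \<partial>lborel)
     = (ennreal ((1 / s) ^ ?n) * (\<integral>\<^sup>+y. F y \<partial>lborel)) * emeasure lborel E"
    using pos by (simp add: nn_integral_lborel_affine DIM_cart nn_integral_cmult)
  also have "\<dots> \<le> (ennreal ((1 / s) ^ ?n) * ennreal ((s * R / 4) powr (- p) / a\<^sup>2 * A)) * emeasure lborel E"
    by (intro mult_right_mono mult_left_mono Fint) auto
  also have "\<dots> = ennreal ((1 / s) ^ ?n * (s * R / 4) powr (- p) / a\<^sup>2 * A) * emeasure lborel E"
    using pos by (simp add: ennreal_mult'[symmetric] mult.assoc)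
  also have "(\<integral>\<^sup>+x. \<integral>\<^sup>+z. \<integral>\<^sup>+\<tau>. g ((\<tau> * s) *\<^sub>R z + (1 - \<tau> * s) *\<^sub>R x) * (indicator Z z * indicator {0<..<1} \<tau>) \<partial>lborel \<partial>lborel \<partial>lborel)
     = (\<integral>\<^sup>+z. \<integral>\<^sup>+x. \<integral>\<^sup>+\<tau>. g ((\<tau> * s) *\<^sub>R z + (1 - \<tau> * s) *\<^sub>R x) * (indicator Z z * indicator {0<..<1} \<tau>) \<partial>lborel \<partial>lborel \<partial>lborel)"
    by (rule lborel_pair.Fubini') measurable
  also have "\<dots> = (\<integral>\<^sup>+z. \<integral>\<^sup>+\<tau>. \<integral>\<^sup>+x. g ((\<tau> * s) *\<^sub>R z + (1 - \<tau> * s) *\<^sub>R x) * (indicator Z z * indicator {0<..<1} \<tau>) \<partial>lborel \<partial>lborel \<partial>lborel)"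
    by (intro nn_integral_cong lborel_pair.Fubini'[symmetric]) measurable
  also have "\<dots> \<le> (\<integral>\<^sup>+z. \<integral>\<^sup>+\<tau>. (ennreal (2 ^ ?n) * (\<integral>\<^sup>+y. g y \<partial>lborel)) * (indicator Z z * indicator {0<..<1::real} \<tau>) \<partial>lborel \<partial>lborel)"
    by (intro nn_integral_mono inner)
  also have "\<dots> = ennreal (2 ^ ?n) * (\<integral>\<^sup>+y. g y \<partial>lborel) * emeasure lborel Z"
    by (simp add: nn_integral_cmult nn_integral_multc mult.assoc)
  also have "\<dots> \<le> ennreal (2 ^ ?n) * (ennreal (1 / a\<^sup>2) * G) * emeasure lborel Z"
    by (intro mult_right_mono mult_left_mono gint) auto
  finally have main: "ennreal (1/4) * (emeasure lborel E * emeasure lborel Z)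
     \<le> ennreal 2 * (ennreal ((1 / s) ^ ?n * (s * R / 4) powr (- p) / a\<^sup>2 * A) * emeasure lborel E)
      + ennreal (8 * (s * R)\<^sup>2) * (ennreal (2 ^ ?n) * (ennreal (1 / a\<^sup>2) * G) * emeasure lborel Z)"
    by (simp add: add_mono mult_left_mono)
  show ?thesis
  \<comment> \<open>Absorbing a term means subtracting it, hence the passage to real numbers. An
    infinite energy makes the right side infinite because its coefficient is positive.\<close>
  proof (cases "G = \<infinity>")
    case True
    have "0 < 64 * 2 ^ ?n * (s * R)\<^sup>2 / a\<^sup>2" using pos by simp
    then show ?thesis using True using pos unfolding G_def by (simp add: ennreal_mult_top)
  next
    case False
    define e where "e = enn2real (emeasure lborel E)"
    define r where "r = enn2real G"
    define V where "V = unit_ball_vol ?n * (R / 4) ^ ?n"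
    define B where "B = (1 / s) ^ ?n * (s * R / 4) powr (- p) / a\<^sup>2 * A"
    have e: "emeasure lborel E = ennreal e" "e \<ge> 0" using Efin by (auto simp: e_def)
    have r: "G = ennreal r" "r \<ge> 0" using False by (auto simp: r_def less_top)
    have V: "V > 0" and B: "B \<ge> 0" using pos by (auto simp: V_def B_def)
    have "ennreal (1/4 * (e * V)) \<le> ennreal (2 * (B * e) + 8 * (s * R)\<^sup>2 * (2 ^ ?n * (1 / a\<^sup>2 * r) * V))"
    proof -
      have "ennreal 2 * (ennreal B * ennreal e) + ennreal c1 * (ennreal c2 * (ennreal c3 * ennreal r) * ennreal V)
          = ennreal (2 * (B * e) + c1 * (c2 * (c3 * r) * V))" if "c1 \<ge> 0" "c2 \<ge> 0" "c3 \<ge> 0" for c1 c2 c3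
        using that V B e r by (simp add: ennreal_mult)
      from this[of "8 * (s * R)\<^sup>2" "2 ^ ?n" "1 / a\<^sup>2"] show ?thesis
        using main V e(2) unfolding e(1) r(1) Zvol V_def[symmetric] B_def[symmetric]
        by (simp add: ennreal_mult[symmetric] del: ennreal_plus)
    qed
    then have "1/4 * (e * V) \<le> 2 * (B * e) + 8 * (s * R)\<^sup>2 * (2 ^ ?n * (1 / a\<^sup>2 * r) * V)"
      using V B e r pos by (subst (asm) ennreal_le_iff) auto
    \<comment> \<open>By \<open>cond\<close> the \<open>F\<close> term is at most half of the left
      side \<open>1/4 * (e * V)\<close> and is absorbed there. The remaining 1/8 against the
      coefficient 8 of \<open>Y\<close> produces the constant 64.\<close>
    moreover have "2 * (B * e) \<le> V / 8 * e"
      using mult_right_mono[OF cond e(2)] by (simp add: B_def V_def mult.assoc)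
    moreover define Y where "Y = (s * R)\<^sup>2 * (2 ^ ?n * (1 / a\<^sup>2 * r) * V)"
    ultimately have "1/4 * (e * V) \<le> 2 * (B * e) + 8 * Y" "2 * (B * e) \<le> 1/8 * (e * V)"
      by (simp_all add: mult.assoc mult.commute mult.left_commute)
    then have "e * V \<le> 64 * Y" by linarith
    then have "e * V \<le> (64 * (s * R)\<^sup>2 * (2 ^ ?n * (1 / a\<^sup>2 * r))) * V"
      by (simp add: Y_def mult.assoc)
    then have "e \<le> 64 * (s * R)\<^sup>2 * (2 ^ ?n * (1 / a\<^sup>2 * r))" using V by (rule mult_right_le_imp_le)
    then have "e \<le> 64 * 2 ^ ?n * (s * R)\<^sup>2 / a\<^sup>2 * r" by (simp add: algebra_simps)
    then have "ennreal e \<le> ennreal (64 * 2 ^ ?n * (s * R)\<^sup>2 / a\<^sup>2 * r)" by (rule ennreal_leI)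
    then show ?thesis
      using r(2) unfolding G_def[symmetric] E_def[symmetric] e(1) r(1)
      by (subst ennreal_mult[symmetric]) auto
  qed
qed

lemma ennreal_mult3:
  assumes "0 \<le> a" "0 \<le> b" "0 \<le> c"
  shows "ennreal a * ennreal b * ennreal c = ennreal (a * b * c)"
  using assms by (simp add: ennreal_mult)

text \<open>Each point is compared with its projection onto the flat part along the axis
  \<open>k\<close>. The segment between them has length at most \<open>R\<close>, and the truncation
  at its end is controlled by the boundary values, whose contribution disappears in the limit for
  functions of zero trace.\<close>

lemma level_estimate_boundary:
  fixes \<phi> :: "real^'n::finite \<Rightarrow> real"
  assumes d: "\<And>x. GDERIV \<phi> x :> d\<phi> x" and c: "continuous_on UNIV d\<phi>"
    and pos: "R > 0" "a > 0"
  shows "emeasure lborel {x \<in> half_ball k R. 2 * a \<le> \<bar>\<phi> x\<bar>}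
     \<le> ennreal (8 * R\<^sup>2 / a\<^sup>2) * level_energy k R a \<phi> d\<phi>
      + ennreal (8 * R / a\<^sup>2) * (\<integral>\<^sup>+x. ennreal ((\<phi> x)\<^sup>2) \<partial>restrict_space (hyperplane_measure k) (flat_part k R))"
proof -
  have [measurable]: "\<phi> \<in> borel_measurable borel" "d\<phi> \<in> borel_measurable borel"
      "trunc' \<in> borel_measurable borel" "trunc \<in> borel_measurable borel"
    using C1_continuous[OF d] c continuous_on_trunc' trunc_deriv
    by (auto intro!: borel_measurable_continuous_onI continuous_at_imp_continuous_on DERIV_isCont)
  let ?\<Omega> = "half_ball k R"
  let ?e = "axis k 1 :: real^'n"
  define \<pi> where "\<pi> = (\<lambda>x::real^'n. \<chi> i. if i = k then 0 else x $ i)"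
  define w where "w = (\<lambda>x. trunc (\<phi> x / a))"
  define dw where "dw = (\<lambda>x. (trunc' (\<phi> x / a) / a) *\<^sub>R d\<phi> x)"
  define G where "G = level_energy k R a \<phi> d\<phi>"
  define B where "B = (\<integral>\<^sup>+x. ennreal ((\<phi> x)\<^sup>2) \<partial>restrict_space (hyperplane_measure k) (flat_part k R))"
  define E where "E = {x \<in> ?\<Omega>. 2 * a \<le> \<bar>\<phi> x\<bar>}"
  define g where "g = (\<lambda>x. ennreal ((norm (dw x))\<^sup>2) * indicator ?\<Omega> x)"
  have [measurable]: "w \<in> borel_measurable borel" "dw \<in> borel_measurable borel" "E \<in> sets borel"
    unfolding w_def dw_def E_def by measurable
  have [measurable]: "g \<in> borel_measurable borel" unfolding g_def by measurable
  have [measurable]: "\<pi> \<in> borel_measurable borel"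
    unfolding \<pi>_def
  proof (intro borel_measurable_continuous_onI continuous_on_vec_lambda)
    show "continuous_on UNIV (\<lambda>x::real^'n. if i = k then 0 else x $ i)" for i
      by (cases "i = k") (auto intro!: continuous_intros)
  qed
  have cdw: "continuous_on UNIV dw"
    unfolding dw_def using pos
    by (intro continuous_intros continuous_on_compose2[OF continuous_on_trunc'] c C1_continuous[OF d]) auto
  \<comment> \<open>The segment is parametrized by the distance \<sigma> = h \<tau> from
    \<open>x\<close>. The squared length h^2 times the Jacobian 1/h leaves h \<le> R, and \<sigma>
    ranges over an interval that is the same for all \<open>x\<close>, so that the integrals can be
    exchanged.\<close>
  have pt: "ennreal (1/4) * indicator E x \<le>
      ennreal (2 / a\<^sup>2) * (ennreal ((\<phi> (\<pi> x))\<^sup>2) * indicator ?\<Omega> x)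
      + ennreal (2 * R) * (\<integral>\<^sup>+\<sigma>. g (- \<sigma> *\<^sub>R ?e + 1 *\<^sub>R x) * indicator {0<..<R} \<sigma> \<partial>lborel)" for x
  proof (cases "x \<in> E")
    case True
    define y where "y = \<pi> x"
    define h where "h = x $ k"
    have x: "x \<in> ?\<Omega>" "2 * a \<le> \<bar>\<phi> x\<bar>" using True by (auto simp: E_def)
    have h: "0 < h" "h \<le> R"
      using x component_le_norm_cart[of x k] by (auto simp: half_ball_def h_def)
    have yx: "y - x = - h *\<^sub>R ?e"
      by (auto simp: y_def h_def \<pi>_def vec_eq_iff axis_def)
    have nyx: "norm (y - x) = h" unfolding yx using h by simp
    have "w x = 1/2" using trunc_top[of "\<phi> x / a"] x pos by (auto simp: w_def field_simps)
    then have "1/4 = (w x)\<^sup>2" by (simp only:) (simp add: power2_eq_square)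
    also have "\<dots> \<le> 2 * (w y)\<^sup>2 + 2 * (w y - w x)\<^sup>2"
      using zero_le_power2[of "2 * w y - w x"] by (simp add: power2_eq_square algebra_simps)
    finally have "ennreal (1/4) \<le> ennreal (2 * (w y)\<^sup>2 + 2 * (w y - w x)\<^sup>2)" by (rule ennreal_leI)
    also have "\<dots> = ennreal (2 * (w y)\<^sup>2) + ennreal 2 * ennreal ((w y - w x)\<^sup>2)"
      by (subst ennreal_plus) (auto simp: ennreal_mult')
    also have "ennreal (2 * (w y)\<^sup>2) \<le> ennreal (2 / a\<^sup>2) * ennreal ((\<phi> y)\<^sup>2)"
    proof -
      have "(w y)\<^sup>2 \<le> (\<phi> y / a)\<^sup>2" unfolding w_def by (rule trunc_sq_le)
      then have "2 * (w y)\<^sup>2 \<le> 2 / a\<^sup>2 * (\<phi> y)\<^sup>2" by (simp add: power_divide)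
      then show ?thesis by (subst ennreal_mult[symmetric]) (auto intro: ennreal_leI)
    qed
    also have "ennreal ((w y - w x)\<^sup>2) \<le> ennreal ((norm (y - x))\<^sup>2) *
        (\<integral>\<^sup>+\<tau>\<in>{0<..<1}. ennreal ((norm (dw (x + \<tau> *\<^sub>R (y - x))))\<^sup>2) \<partial>lborel)"
      using trunc_gderiv[OF d \<open>a > 0\<close>] cdw
      by (intro segment_increment_sq_le) (auto simp: w_def dw_def)
    also have "(\<integral>\<^sup>+\<tau>\<in>{0<..<1}. ennreal ((norm (dw (x + \<tau> *\<^sub>R (y - x))))\<^sup>2) \<partial>lborel)
      \<le> (\<integral>\<^sup>+\<tau>. g (- (0 + h *\<^sub>R \<tau>) *\<^sub>R ?e + 1 *\<^sub>R x) * indicator {0<..<R} (0 + h *\<^sub>R \<tau>) \<partial>lborel)"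
    proof (rule nn_integral_mono)
      fix \<tau> :: real
      have eq: "x + \<tau> *\<^sub>R (y - x) = - (0 + h *\<^sub>R \<tau>) *\<^sub>R ?e + 1 *\<^sub>R x" by (simp add: yx mult.commute)
      have "x + \<tau> *\<^sub>R (y - x) \<in> ?\<Omega> \<and> 0 < h * \<tau> \<and> h * \<tau> < R" if t: "0 < \<tau>" "\<tau> < 1"
      proof -
        have 1: "0 < h * \<tau>" "h * \<tau> < h" using t h by auto
        have k: "(x + \<tau> *\<^sub>R (y - x)) $ k = h - h * \<tau>" unfolding yx by (simp add: h_def)
        have "norm (x + \<tau> *\<^sub>R (y - x)) \<le> norm x"
        proof (rule norm_le_componentwise_cart)
          fix i
          show "norm ((x + \<tau> *\<^sub>R (y - x)) $ i) \<le> norm (x $ i)"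
          proof (cases "i = k")
            case True
            then show ?thesis using k 1 by (simp add: h_def)
          next
            case False
            then show ?thesis unfolding yx by (simp add: axis_def)
          qed
        qed
        moreover have "h * \<tau> < R" using 1 h by linarith
        ultimately show ?thesis using x 1 k by (auto simp: half_ball_def)
      qed
      then show "ennreal ((norm (dw (x + \<tau> *\<^sub>R (y - x))))\<^sup>2) * indicator {0<..<1} \<tau>
        \<le> g (- (0 + h *\<^sub>R \<tau>) *\<^sub>R ?e + 1 *\<^sub>R x) * indicator {0<..<R} (0 + h *\<^sub>R \<tau>)"
        unfolding eq[symmetric] by (auto simp: g_def indicator_def)
    qed
    also have "\<dots> = ennreal (1 / h) * (\<integral>\<^sup>+\<sigma>. g (- \<sigma> *\<^sub>R ?e + 1 *\<^sub>R x) * indicator {0<..<R} \<sigma> \<partial>lborel)"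
      using nn_integral_lborel_affine[of "\<lambda>\<sigma>::real. g (- \<sigma> *\<^sub>R ?e + 1 *\<^sub>R x) * indicator {0<..<R} \<sigma>" h 0] h
      by simp
    finally have "ennreal (1/4) \<le> ennreal (2 / a\<^sup>2) * ennreal ((\<phi> y)\<^sup>2) + ennreal 2 * (ennreal ((norm (y - x))\<^sup>2) *
        (ennreal (1 / h) * (\<integral>\<^sup>+\<sigma>. g (- \<sigma> *\<^sub>R ?e + 1 *\<^sub>R x) * indicator {0<..<R} \<sigma> \<partial>lborel)))"
      by (simp add: add_mono mult_left_mono)
    also have "ennreal 2 * (ennreal ((norm (y - x))\<^sup>2) * (ennreal (1 / h) * I)) = ennreal (2 * h) * I" for I
      unfolding nyx mult.assoc[symmetric] using h
      by (subst ennreal_mult3) (auto simp: power2_eq_square)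
    also have "ennreal (2 * h) * I \<le> ennreal (2 * R) * I" for I
      using h by (intro mult_right_mono ennreal_leI) auto
    finally show ?thesis using True x by (simp add: y_def add_mono)
  qed simp
  have gint: "(\<integral>\<^sup>+x. g x \<partial>lborel) \<le> ennreal (1 / a\<^sup>2) * G"
    using truncated_energy_le[OF \<open>a > 0\<close> d c] by (simp add: g_def dw_def G_def)
  \<comment> \<open>For fixed \<open>\<sigma>\<close> the map in \<open>x\<close> is a translation.
    The factor 1 in \<open>1 *\<^sub>R x\<close> keeps the form of the affine substitution.\<close>
  have inner: "(\<integral>\<^sup>+x. g (- \<sigma> *\<^sub>R ?e + 1 *\<^sub>R x) * indicator {0<..<R} \<sigma> \<partial>lborel)
      = (\<integral>\<^sup>+x. g x \<partial>lborel) * indicator {0<..<R} \<sigma>" for \<sigma> :: real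
    using nn_integral_lborel_affine[of g 1 "- \<sigma> *\<^sub>R ?e"]
    by (subst nn_integral_multc) (simp_all del: scaleR_one)
  have "ennreal (1/4) * emeasure lborel E = (\<integral>\<^sup>+x. ennreal (1/4) * indicator E x \<partial>lborel)"
    by (simp add: nn_integral_cmult)
  also have "\<dots> \<le> (\<integral>\<^sup>+x. ennreal (2 / a\<^sup>2) * (ennreal ((\<phi> (\<pi> x))\<^sup>2) * indicator ?\<Omega> x)
      + ennreal (2 * R) * (\<integral>\<^sup>+\<sigma>. g (- \<sigma> *\<^sub>R ?e + 1 *\<^sub>R x) * indicator {0<..<R} \<sigma> \<partial>lborel) \<partial>lborel)"
    by (intro nn_integral_mono pt)
  also have "\<dots> = ennreal (2 / a\<^sup>2) * (\<integral>\<^sup>+x\<in>?\<Omega>. ennreal ((\<phi> (\<pi> x))\<^sup>2) \<partial>lborel)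
      + ennreal (2 * R) * (\<integral>\<^sup>+x. \<integral>\<^sup>+\<sigma>. g (- \<sigma> *\<^sub>R ?e + 1 *\<^sub>R x) * indicator {0<..<R} \<sigma> \<partial>lborel \<partial>lborel)"
    by (simp add: nn_integral_add nn_integral_cmult del: scaleR_one)
  also have "(\<integral>\<^sup>+x. \<integral>\<^sup>+\<sigma>. g (- \<sigma> *\<^sub>R ?e + 1 *\<^sub>R x) * indicator {0<..<R} \<sigma> \<partial>lborel \<partial>lborel)
     = (\<integral>\<^sup>+\<sigma>. \<integral>\<^sup>+x. g (- \<sigma> *\<^sub>R ?e + 1 *\<^sub>R x) * indicator {0<..<R} \<sigma> \<partial>lborel \<partial>lborel)"
    by (rule lborel_pair.Fubini'[symmetric]) measurable
  also have "\<dots> = (\<integral>\<^sup>+\<sigma>. (\<integral>\<^sup>+x. g x \<partial>lborel) * indicator {0<..<R} \<sigma> \<partial>lborel)"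
    by (simp only: inner)
  also have "\<dots> = (\<integral>\<^sup>+x. g x \<partial>lborel) * ennreal R"
    using pos by (subst nn_integral_cmult_indicator) auto
  also have "\<dots> \<le> (ennreal (1 / a\<^sup>2) * G) * ennreal R"
    by (intro mult_right_mono gint) auto
  also have "(\<integral>\<^sup>+x\<in>?\<Omega>. ennreal ((\<phi> (\<pi> x))\<^sup>2) \<partial>lborel) \<le> ennreal R * B"
    using nn_integral_half_ball_trace_le[of "\<lambda>x. ennreal ((\<phi> x)\<^sup>2)" R k] pos
    by (simp add: \<pi>_def B_def)
  finally have main: "ennreal (1/4) * emeasure lborel E
     \<le> ennreal (2 / a\<^sup>2) * (ennreal R * B) + ennreal (2 * R) * ((ennreal (1 / a\<^sup>2) * G) * ennreal R)"
    by (simp add: add_mono mult_left_mono)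
  have "emeasure lborel E = ennreal 4 * (ennreal (1/4) * emeasure lborel E)"
    unfolding mult.assoc[symmetric] by (subst ennreal_mult[symmetric]) auto
  also have "\<dots> \<le> ennreal 4 * (ennreal (2 / a\<^sup>2) * (ennreal R * B) + ennreal (2 * R) * ((ennreal (1 / a\<^sup>2) * G) * ennreal R))"
    by (intro mult_left_mono main) auto
  also have "\<dots> = ennreal (8 * R / a\<^sup>2) * B + ennreal (8 * R\<^sup>2 / a\<^sup>2) * G"
  proof -
    have "ennreal 4 * (ennreal (2 / a\<^sup>2) * (ennreal R * B)) = (ennreal 4 * ennreal (2 / a\<^sup>2) * ennreal R) * B"
      by (simp only: ac_simps)
    also have "ennreal 4 * ennreal (2 / a\<^sup>2) * ennreal R = ennreal (8 * R / a\<^sup>2)"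
      using pos by (subst ennreal_mult3) auto
    finally have 1: "ennreal 4 * (ennreal (2 / a\<^sup>2) * (ennreal R * B)) = ennreal (8 * R / a\<^sup>2) * B" .
    have "ennreal 4 * (ennreal (2 * R) * ((ennreal (1 / a\<^sup>2) * G) * ennreal R))
        = (ennreal 4 * ennreal (2 * R) * ennreal (1 / a\<^sup>2) * ennreal R) * G"
      by (simp only: ac_simps)
    also have "ennreal 4 * ennreal (2 * R) * ennreal (1 / a\<^sup>2) * ennreal R = ennreal (8 * R\<^sup>2 / a\<^sup>2)"
      using pos by (subst ennreal_mult3, simp_all, subst ennreal_mult[symmetric])
        (auto simp: power2_eq_square)
    finally have 2: "ennreal 4 * (ennreal (2 * R) * ((ennreal (1 / a\<^sup>2) * G) * ennreal R)) = ennreal (8 * R\<^sup>2 / a\<^sup>2) * G" .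
    show ?thesis by (simp only: distrib_left 1 2)
  qed
  finally show ?thesis by (simp add: E_def G_def B_def add.commute)
qed

text \<open>The quotient in parentheses is the \<open>K\<close> in \<rho>^(n + p) = K A / a^2 for
  which the smallness condition of the interior estimate holds with equality;
  \<open>64 * 2 ^ n\<close> is the constant of that estimate.\<close>

definition level_const :: "nat \<Rightarrow> real \<Rightarrow> real \<Rightarrow> real" where
  "level_const n p \<beta> = 64 * 2 ^ n * (16 * 4 ^ n * 4 powr p / unit_ball_vol (real n)) powr \<beta>"

lemma level_const_pos: "level_const n p \<beta> > 0"
proof -
  have "0 < 16 * 4 ^ n * 4 powr p / unit_ball_vol (real n)"
    by (intro divide_pos_pos mult_pos_pos) auto
  then have "0 < (16 * 4 ^ n * 4 powr p / unit_ball_vol (real n)) powr \<beta>"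
    by (simp only: powr_gt_zero)
  then show ?thesis unfolding level_const_def by (intro mult_pos_pos) auto
qed

text \<open>The exponents \<open>\<theta> \<in> [0, 1]\<close> trade the natural length \<open>\<rho>\<close> of the level \<open>a\<close> for powers of
  the radius, through \<open>(min R \<rho>)\<^sup>2 \<le> R\<^bsup>2 - 2 \<theta>\<^esup> \<rho>\<^bsup>2 \<theta>\<^esup>\<close>.\<close>

lemma level_estimate_C1:
  fixes \<phi> :: "real^'n::finite \<Rightarrow> real"
  assumes d: "\<And>x. GDERIV \<phi> x :> d\<phi> x" and c: "continuous_on UNIV d\<phi>"
    and pos: "R > 0" "a > 0" "p \<ge> 0" "A > 0" and \<theta>: "0 \<le> \<theta>" "\<theta> \<le> 1"
    and \<beta>: "\<beta> = 2 * \<theta> / (real CARD('n) + p)"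
    and A: "weighted_L2_sq k p R \<phi> \<le> ennreal A"
  shows "emeasure lborel {x \<in> half_ball k R. 2 * a \<le> \<bar>\<phi> x\<bar>}
     \<le> ennreal (level_const CARD('n) p \<beta> * R powr (2 * (1 - \<theta>)) * A powr \<beta> * a powr (- 2 - 2 * \<beta>)) * level_energy k R a \<phi> d\<phi>
      + ennreal (8 * R / a\<^sup>2) * (\<integral>\<^sup>+x. ennreal ((\<phi> x)\<^sup>2) \<partial>restrict_space (hyperplane_measure k) (flat_part k R))"
    (is "_ \<le> ennreal ?C * ?G + ?B")
proof -
  let ?n = "CARD('n)"
  define V where "V = unit_ball_vol (real ?n)"
  define K where "K = 16 * 4 ^ ?n * 4 powr p / V"
  define \<rho> where "\<rho> = (K * A / a\<^sup>2) powr (1 / (real ?n + p))"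
  have V: "V > 0" by (simp add: V_def)
  have K: "K > 0" using V by (simp add: K_def)
  have np: "real ?n + p > 0" using pos by (intro add_pos_nonneg) (auto simp: card_gt_0_iff)
  have \<rho>: "\<rho> > 0" using K pos by (simp add: \<rho>_def)
  have \<rho>np: "\<rho> ^ ?n * \<rho> powr p = K * A / a\<^sup>2"
  proof -
    have "\<rho> ^ ?n * \<rho> powr p = \<rho> powr (real ?n + p)" using \<rho> by (simp add: powr_add powr_realpow)
    also have "\<dots> = (K * A / a\<^sup>2) powr 1" unfolding \<rho>_def powr_powr using np by simp
    finally show ?thesis using K pos by simp
  qed
  define m where "m = min R \<rho>"
  have m: "m > 0" "m \<le> R" "m \<le> \<rho>" using \<rho> pos by (auto simp: m_def)
  have msq: "m\<^sup>2 \<le> R powr (2 * (1 - \<theta>)) * \<rho> powr (2 * \<theta>)"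
  proof -
    have "m\<^sup>2 = m powr (2 * (1 - \<theta>) + 2 * \<theta>)" using m by (simp add: algebra_simps)
    also have "\<dots> = m powr (2 * (1 - \<theta>)) * m powr (2 * \<theta>)" by (rule powr_add)
    also have "\<dots> \<le> R powr (2 * (1 - \<theta>)) * \<rho> powr (2 * \<theta>)"
      using m \<theta> by (intro mult_mono powr_mono2) auto
    finally show ?thesis .
  qed
  have \<rho>\<theta>: "\<rho> powr (2 * \<theta>) = K powr \<beta> * A powr \<beta> * a powr (- 2 * \<beta>)"
  proof -
    have "\<rho> powr (2 * \<theta>) = (K * A / a\<^sup>2) powr \<beta>" unfolding \<rho>_def powr_powr \<beta> by simp
    also have "\<dots> = K powr \<beta> * A powr \<beta> / (a powr 2) powr \<beta>"
      using K pos by (simp add: powr_mult powr_divide)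
    also have "\<dots> = K powr \<beta> * A powr \<beta> * a powr (- 2 * \<beta>)"
      by (simp add: powr_powr powr_minus field_simps)
    finally show ?thesis .
  qed
  have C: "64 * 2 ^ ?n * m\<^sup>2 / a\<^sup>2 \<le> ?C"
  proof -
    have "64 * 2 ^ ?n * m\<^sup>2 / a\<^sup>2 \<le> 64 * 2 ^ ?n * (R powr (2 * (1 - \<theta>)) * \<rho> powr (2 * \<theta>)) / a\<^sup>2"
      using msq pos by (intro divide_right_mono mult_left_mono) auto
    also have "\<dots> = ?C"
    proof -
      have "a powr (- 2 - 2 * \<beta>) = a powr (- 2 * \<beta>) / a\<^sup>2"
        using pos by (simp add: powr_diff powr_minus field_simps)
      then show ?thesis unfolding \<rho>\<theta> level_const_def V_def[symmetric] K_def[symmetric] by simp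
    qed
    finally show ?thesis .
  qed
  show ?thesis
  \<comment> \<open>Moving by the fraction s = \<rho> / R requires s \<le> 1/2. For larger \<rho>
    one has R \<le> 2 m, so the boundary constant 8 R^2 is at most 32 m^2 and fits under the
    interior one.\<close>
  proof (cases "\<rho> \<le> R / 2")
    case True
    define s where "s = \<rho> / R"
    have s: "0 < s" "s \<le> 1/2" "s * R = \<rho>" using True \<rho> pos by (auto simp: s_def field_simps)
    have "emeasure lborel {x \<in> half_ball k R. 2 * a \<le> \<bar>\<phi> x\<bar>} \<le> ennreal (64 * 2 ^ ?n * (s * R)\<^sup>2 / a\<^sup>2) * ?G"
    proof (rule level_estimate_interior[OF d c _ _ _ _ _ _ A])
      have "2 * ((1 / s) ^ ?n * (s * R / 4) powr (- p) / a\<^sup>2 * A)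
          = 2 * R ^ ?n * 4 powr p * A / a\<^sup>2 / (\<rho> ^ ?n * \<rho> powr p)"
        unfolding s(3) using \<rho> pos by (simp add: s_def power_divide powr_minus powr_divide field_simps)
      also have "\<dots> = V * (R / 4) ^ ?n / 8"
        unfolding \<rho>np using V pos by (simp add: K_def power_divide field_simps)
      finally show "2 * ((1 / s) ^ ?n * (s * R / 4) powr (- p) / a\<^sup>2 * A)
         \<le> unit_ball_vol (real ?n) * (R / 4) ^ ?n / 8" by (simp add: V_def)
    qed (use s pos in auto)
    also have "(s * R)\<^sup>2 = m\<^sup>2" using True pos unfolding s(3) m_def by (simp add: min_def)
    also have "ennreal (64 * 2 ^ ?n * m\<^sup>2 / a\<^sup>2) * ?G \<le> ennreal ?C * ?G"
      by (intro mult_right_mono ennreal_leI C) auto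
    also have "\<dots> \<le> ennreal ?C * ?G + ?B" by simp
    finally show ?thesis .
  next
    case False
    have "R \<le> 2 * m" using False pos by (auto simp: m_def)
    then have "R\<^sup>2 \<le> (2 * m)\<^sup>2" using pos by (intro power_mono) auto
    then have "8 * R\<^sup>2 / a\<^sup>2 \<le> 32 * m\<^sup>2 / a\<^sup>2"
      by (intro divide_right_mono) (auto simp: power_mult_distrib)
    also have "\<dots> \<le> 64 * 2 ^ ?n * m\<^sup>2 / a\<^sup>2"
    proof (intro divide_right_mono mult_right_mono)
      have "(1::real) \<le> 2 ^ ?n" by simp
      then show "32 \<le> 64 * (2::real) ^ ?n" by linarith
    qed auto
    also note C
    finally have "ennreal (8 * R\<^sup>2 / a\<^sup>2) * ?G \<le> ennreal ?C * ?G"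
      by (intro mult_right_mono ennreal_leI) auto
    then show ?thesis
      using level_estimate_boundary[OF d c pos(1,2), of k] by (meson add_right_mono order_trans)
  qed
qed

section \<open>Interpolation inequalities\<close>

lemma borel_measurable_lebesgue_on:
  "f \<in> borel_measurable borel \<Longrightarrow> f \<in> borel_measurable (lebesgue_on S)"
  by (intro measurable_restrict_space1 measurable_completion) simp

text \<open>Convergence in L1 yields almost everywhere convergence along a subsequence. Finitely
  many of the integrals may be infinite, so the sequence is first shifted by
  \<open>N\<close>.\<close>

lemma nn_integral_tendsto_0_AE_subseq:
  fixes f :: "nat \<Rightarrow> 'a \<Rightarrow> real"
  assumes [measurable]: "\<And>m. f m \<in> borel_measurable M" and nn: "\<And>m x. 0 \<le> f m x"
    and lim: "(\<lambda>m. \<integral>\<^sup>+x. ennreal (f m x) \<partial>M) \<longlonglongrightarrow> 0"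
  obtains r :: "nat \<Rightarrow> nat" where "strict_mono r" "AE x in M. (\<lambda>m. f (r m) x) \<longlonglongrightarrow> 0"
proof -
  have "eventually (\<lambda>m. (\<integral>\<^sup>+x. ennreal (f m x) \<partial>M) < 1) sequentially"
    using lim by (rule order_tendstoD) simp
  then obtain N where N: "\<And>m. m \<ge> N \<Longrightarrow> (\<integral>\<^sup>+x. ennreal (f m x) \<partial>M) < 1"
    by (auto simp: eventually_sequentially)
  define u where "u m = f (m + N)" for m
  have u: "integrable M (u m)" for m
  proof (rule integrableI_nonneg)
    show "(\<integral>\<^sup>+x. ennreal (u m x) \<partial>M) < \<infinity>"
      using N[of "m + N"] by (auto simp: u_def intro: less_trans)
  qed (auto simp: u_def nn)
  have "(\<lambda>m. ennreal (\<integral>x. norm (u m x) \<partial>M)) \<longlonglongrightarrow> ennreal 0"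
  proof -
    have "ennreal (\<integral>x. norm (u m x) \<partial>M) = (\<integral>\<^sup>+x. ennreal (f (m + N) x) \<partial>M)" for m
      using nn_integral_eq_integral[OF u[of m]] nn by (simp add: u_def)
    then show ?thesis using LIMSEQ_ignore_initial_segment[OF lim, of N] by simp
  qed
  then have "(\<lambda>m. \<integral>x. norm (u m x) \<partial>M) \<longlonglongrightarrow> 0"
    by (subst (asm) tendsto_ennreal_iff) auto
  from tendsto_L1_AE_subseq[OF u this] obtain r :: "nat \<Rightarrow> nat" where
    r: "strict_mono r" "AE x in M. (\<lambda>n. u (r n) x) \<longlonglongrightarrow> 0" by auto
  show thesis
    by (rule that[of "\<lambda>m. r m + N"]) (use r in \<open>auto simp: u_def strict_mono_def\<close>)
qed

text \<open>Smoothness supplies some gradient with continuous components. The derivative is unique,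
  and testing it with the difference of the two fields identifies this gradient with the given
  \<open>d\<phi>\<close>.\<close>

lemma smooth_continuous_gradient:
  assumes "smooth \<phi>" and d: "\<And>x. GDERIV \<phi> x :> d\<phi> x"
  shows "continuous_on UNIV d\<phi>"
proof -
  have "C_k (Suc 0) \<phi>" using assms(1) by (auto simp only: smooth_def)
  then obtain g where g: "\<And>x. GDERIV \<phi> x :> g x" "\<And>i. continuous_on UNIV (\<lambda>x. g x $ i)"
    by auto
  have "g x = d\<phi> x" for x
  proof -
    have "(\<lambda>h. h \<bullet> g x) = (\<lambda>h. h \<bullet> d\<phi> x)"
      using has_derivative_unique g(1)[of x] d[of x] unfolding gderiv_def by blast
    then have "(g x - d\<phi> x) \<bullet> g x = (g x - d\<phi> x) \<bullet> d\<phi> x" by (rule fun_cong)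
    then have "(g x - d\<phi> x) \<bullet> (g x - d\<phi> x) = 0" by (simp only: inner_diff_right)
    then show ?thesis by simp
  qed
  then have "d\<phi> = g" by auto
  moreover have "continuous_on UNIV (\<lambda>x. \<chi> i. g x $ i)"
    by (intro continuous_on_vec_lambda g)
  ultimately show ?thesis by simp
qed

text \<open>On the half ball the weight is at most R^p, as p \<ge> 0, so convergence in L2 carries
  over to the weighted space. The strict inequality for \<open>v\<close> leaves the room that the
  approximations need.\<close>

lemma weighted_L2_sq_limit:
  fixes v :: "real^'n::finite \<Rightarrow> real"
  assumes [measurable]: "v \<in> borel_measurable (lebesgue_on (half_ball k R))"
      "\<And>m. \<phi> m \<in> borel_measurable (lebesgue_on (half_ball k R))"
    and lim: "(\<lambda>m. \<integral>\<^sup>+x. ennreal ((\<phi> m x - v x)\<^sup>2) \<partial>lebesgue_on (half_ball k R)) \<longlonglongrightarrow> 0"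
    and A: "weighted_L2_sq k p R v < ennreal A" and pos: "p \<ge> 0" "R > 0"
  shows "eventually (\<lambda>m. weighted_L2_sq k p R (\<phi> m) \<le> ennreal A) sequentially"
proof -
  let ?M = "lebesgue_on (half_ball k R)"
  have [measurable]: "(\<lambda>x. x $ k) \<in> borel_measurable ?M"
    by (intro borel_measurable_lebesgue_on borel_measurable_continuous_onI continuous_intros)
  have A0: "A > 0" using A by (metis ennreal_less_zero_iff not_gr_zero not_less_zero)
  obtain W where W: "weighted_L2_sq k p R v = ennreal W" "W \<ge> 0"
    using A by (cases "weighted_L2_sq k p R v") auto
  have WA: "W < A" using A W by (simp add: ennreal_less_iff)
  \<comment> \<open>The parameter of Young's inequality (s + t)^2 \<le> (1 + \<delta>) s^2 + (1 +
    1/\<delta>) t^2. This choice spends at most half of the gap between \<open>W\<close> and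
    \<open>A\<close>.\<close>
  define \<delta> where "\<delta> = (A - W) / (2 * A)"
  have \<delta>: "\<delta> > 0" using WA A0 by (simp add: \<delta>_def)
  have \<delta>W: "(1 + \<delta>) * W < A"
  proof -
    have "\<delta> * W \<le> \<delta> * A" using WA \<delta> by (intro mult_left_mono) auto
    also have "\<dots> = (A - W) / 2" using A0 by (simp add: \<delta>_def)
    finally show ?thesis using WA by (simp add: algebra_simps)
  qed
  have le: "weighted_L2_sq k p R (\<phi> m) \<le> ennreal ((1 + \<delta>) * W) +
      ennreal ((1 + 1 / \<delta>) * R powr p) * (\<integral>\<^sup>+x. ennreal ((\<phi> m x - v x)\<^sup>2) \<partial>?M)" for m
  proof -
    have "weighted_L2_sq k p R (\<phi> m) \<le> (\<integral>\<^sup>+x. ennreal (1 + \<delta>) * ennreal ((v x)\<^sup>2 * (x $ k) powr p)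
       + ennreal ((1 + 1 / \<delta>) * R powr p) * ennreal ((\<phi> m x - v x)\<^sup>2) \<partial>?M)"
      unfolding weighted_L2_sq_def
    proof (rule nn_integral_mono)
      fix x assume "x \<in> space ?M"
      then have x: "0 < x $ k" "x $ k \<le> R"
        using component_le_norm_cart[of x k] by (auto simp: half_ball_def space_restrict_space)
      define b where "b = (x $ k) powr p"
      have b: "0 \<le> b" "b \<le> R powr p" using x pos by (auto simp: b_def intro: powr_mono2)
      have "(\<phi> m x)\<^sup>2 \<le> (1 + \<delta>) * (v x)\<^sup>2 + (1 + 1 / \<delta>) * (\<phi> m x - v x)\<^sup>2"
      proof -
        define s t where "s = v x" and "t = \<phi> m x - v x"
        have "0 \<le> (\<delta> * s - t)\<^sup>2 / \<delta>" using \<delta> by simp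
        also have "\<dots> = \<delta> * s\<^sup>2 - 2 * s * t + t\<^sup>2 / \<delta>"
          using \<delta> by (simp add: power2_eq_square field_simps)
        finally have "(s + t)\<^sup>2 \<le> (1 + \<delta>) * s\<^sup>2 + (1 + 1 / \<delta>) * t\<^sup>2"
          by (simp add: power2_eq_square algebra_simps)
        then show ?thesis by (simp add: s_def t_def)
      qed
      then have "(\<phi> m x)\<^sup>2 * b \<le> ((1 + \<delta>) * (v x)\<^sup>2 + (1 + 1 / \<delta>) * (\<phi> m x - v x)\<^sup>2) * b"
        using b by (intro mult_right_mono)
      also have "\<dots> = (1 + \<delta>) * ((v x)\<^sup>2 * b) + (1 + 1 / \<delta>) * (\<phi> m x - v x)\<^sup>2 * b"
        by (simp add: algebra_simps)
      also have "\<dots> \<le> (1 + \<delta>) * ((v x)\<^sup>2 * b) + (1 + 1 / \<delta>) * (\<phi> m x - v x)\<^sup>2 * R powr p"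
        using b \<delta> by (intro add_left_mono mult_left_mono) auto
      finally have "ennreal ((\<phi> m x)\<^sup>2 * b) \<le> ennreal ((1 + \<delta>) * ((v x)\<^sup>2 * b) + (1 + 1 / \<delta>) * R powr p * (\<phi> m x - v x)\<^sup>2)"
        by (intro ennreal_leI) (simp add: mult.assoc mult.commute)
      also have "\<dots> = ennreal (1 + \<delta>) * ennreal ((v x)\<^sup>2 * b) + ennreal ((1 + 1 / \<delta>) * R powr p) * ennreal ((\<phi> m x - v x)\<^sup>2)"
        using b \<delta> by (subst ennreal_plus) (auto simp: ennreal_mult simp del: ennreal_plus)
      finally show "ennreal ((\<phi> m x)\<^sup>2 * (x $ k) powr p) \<le> ennreal (1 + \<delta>) * ennreal ((v x)\<^sup>2 * (x $ k) powr p)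
          + ennreal ((1 + 1 / \<delta>) * R powr p) * ennreal ((\<phi> m x - v x)\<^sup>2)" by (simp only: b_def)
    qed
    also have "\<dots> = ennreal (1 + \<delta>) * weighted_L2_sq k p R v +
       ennreal ((1 + 1 / \<delta>) * R powr p) * (\<integral>\<^sup>+x. ennreal ((\<phi> m x - v x)\<^sup>2) \<partial>?M)"
      unfolding weighted_L2_sq_def by (simp add: nn_integral_add nn_integral_cmult del: ennreal_plus)
    finally show ?thesis using \<delta> W by (simp add: ennreal_mult del: ennreal_plus)
  qed
  have "(\<lambda>m. ennreal ((1 + \<delta>) * W) +
      ennreal ((1 + 1 / \<delta>) * R powr p) * (\<integral>\<^sup>+x. ennreal ((\<phi> m x - v x)\<^sup>2) \<partial>?M)) \<longlonglongrightarrow> ennreal ((1 + \<delta>) * W) + ennreal ((1 + 1 / \<delta>) * R powr p) * 0"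
    by (intro tendsto_add tendsto_const ennreal_tendsto_cmult lim) auto
  then have "(\<lambda>m. ennreal ((1 + \<delta>) * W) +
      ennreal ((1 + 1 / \<delta>) * R powr p) * (\<integral>\<^sup>+x. ennreal ((\<phi> m x - v x)\<^sup>2) \<partial>?M)) \<longlonglongrightarrow> ennreal ((1 + \<delta>) * W)"
    by simp
  then have "eventually (\<lambda>m. ennreal ((1 + \<delta>) * W) +
      ennreal ((1 + 1 / \<delta>) * R powr p) * (\<integral>\<^sup>+x. ennreal ((\<phi> m x - v x)\<^sup>2) \<partial>?M) < ennreal A) sequentially"
    by (rule order_tendstoD) (use \<delta>W W \<delta> in \<open>simp add: ennreal_less_iff\<close>)
  then show ?thesis
    by eventually_elim (use le in \<open>meson less_imp_le order_trans\<close>)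
qed

text \<open>The estimate for smooth functions passes to the limit: the boundary term tends to zero,
  Fatou's lemma serves the left side and dominated convergence the energy. The factor 2 comes from
  splitting the gradient of an approximation into the weak gradient and an error.\<close>

lemma level_estimate_H1_0L:
  fixes v :: "real^'n::finite \<Rightarrow> real"
  assumes v: "v \<in> H1_0L k R" and pos: "R > 0" "a > 0" "p \<ge> 0" and \<theta>: "0 \<le> \<theta>" "\<theta> \<le> 1"
    and \<beta>: "\<beta> = 2 * \<theta> / (real CARD('n) + p)"
    and A: "weighted_L2_sq k p R v < ennreal A"
  shows "(\<integral>\<^sup>+x. of_bool (2 * a < \<bar>v x\<bar>) \<partial>lebesgue_on (half_ball k R))
     \<le> ennreal (2 * (level_const CARD('n) p \<beta> * R powr (2 * (1 - \<theta>)) * A powr \<beta> * a powr (- 2 - 2 * \<beta>)))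
        * level_energy k R a v (weak_grad (half_ball k R) v)"
proof -
  let ?M = "lebesgue_on (half_ball k R)"
  define g where "g = weak_grad (half_ball k R) v"
  define C where "C = level_const CARD('n) p \<beta> * R powr (2 * (1 - \<theta>)) * A powr \<beta> * a powr (- 2 - 2 * \<beta>)"
  have C: "C \<ge> 0" unfolding C_def by (intro mult_nonneg_nonneg less_imp_le[OF level_const_pos]) auto
  have A0: "A > 0" using A by (metis ennreal_less_zero_iff not_gr_zero not_less_zero)
  have [measurable]: "v \<in> borel_measurable ?M" "g \<in> borel_measurable ?M"
    and gfin: "(\<integral>\<^sup>+x. ennreal ((norm (g x))\<^sup>2) \<partial>?M) < \<infinity>"
    using v by (auto simp: H1_0L_def H1_def L2_def g_def)
  obtain \<phi> d\<phi> where \<phi>: "\<And>m. smooth (\<phi> m)" "\<And>m x. GDERIV (\<phi> m) x :> d\<phi> m x"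
    and lim1: "(\<lambda>m. \<integral>\<^sup>+x. ennreal ((\<phi> m x - v x)\<^sup>2) \<partial>?M) \<longlonglongrightarrow> 0"
    and lim2: "(\<lambda>m. \<integral>\<^sup>+x. ennreal ((norm (d\<phi> m x - g x))\<^sup>2) \<partial>?M) \<longlonglongrightarrow> 0"
    and lim3: "(\<lambda>m. \<integral>\<^sup>+x. ennreal ((\<phi> m x)\<^sup>2) \<partial>restrict_space (hyperplane_measure k) (flat_part k R)) \<longlonglongrightarrow> 0"
    using v by (auto simp: H1_0L_def has_flat_trace_def g_def)
  have cd: "continuous_on UNIV (d\<phi> m)" for m by (rule smooth_continuous_gradient[OF \<phi>])
  have bm: "\<phi> m \<in> borel_measurable borel" "d\<phi> m \<in> borel_measurable borel" for m
    using cd C1_continuous[OF \<phi>(2)] by (auto intro: borel_measurable_continuous_onI)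
  have [measurable]: "\<phi> m \<in> borel_measurable ?M" "d\<phi> m \<in> borel_measurable ?M" for m
    using bm[of m] by (auto intro!: borel_measurable_lebesgue_on)
  obtain r where r: "strict_mono r" and AEr: "AE x in ?M. (\<lambda>m. (\<phi> (r m) x - v x)\<^sup>2) \<longlonglongrightarrow> 0"
    by (rule nn_integral_tendsto_0_AE_subseq[OF _ _ lim1]) auto
  have AEv: "AE x in ?M. (\<lambda>m. \<phi> (r m) x) \<longlonglongrightarrow> v x"
    using AEr
  proof eventually_elim
    case (elim x)
    from tendsto_real_sqrt[OF elim] have "(\<lambda>m. \<bar>\<phi> (r m) x - v x\<bar>) \<longlonglongrightarrow> 0" by simp
    then have "(\<lambda>m. \<phi> (r m) x - v x) \<longlonglongrightarrow> 0" by (simp add: tendsto_rabs_zero_iff)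
    then show ?case by (simp add: LIM_zero_iff)
  qed
  define D where "D m = (\<integral>\<^sup>+x. ennreal ((norm (d\<phi> m x - g x))\<^sup>2) \<partial>?M)" for m
  define B where "B m = (\<integral>\<^sup>+x. ennreal ((\<phi> m x)\<^sup>2) \<partial>restrict_space (hyperplane_measure k) (flat_part k R))" for m
  define lev where "lev t \<longleftrightarrow> a \<le> \<bar>t\<bar> \<and> \<bar>t\<bar> \<le> 2 * a" for t :: real
  have [measurable]: "Measurable.pred borel lev" unfolding lev_def by measurable
  \<comment> \<open>With the fixed \<open>g\<close> in place of the varying gradient there is an
    integrable majorant. Including \<open>lev (v x)\<close> in the condition makes the indicator
    converge even where |v| equals a or 2 a: on the closed shell of \<open>v\<close> it is
    constantly one, off it eventually zero.\<close>
  define L where "L m = (\<integral>\<^sup>+x. ennreal (of_bool (lev (\<phi> m x) \<or> lev (v x)) * (norm (g x))\<^sup>2) \<partial>?M)" for m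
  have energy: "level_energy k R a (\<phi> m) (d\<phi> m) \<le> ennreal 2 * D m + ennreal 2 * L m" for m
  proof -
    have "level_energy k R a (\<phi> m) (d\<phi> m) \<le>
      (\<integral>\<^sup>+x. ennreal 2 * ennreal ((norm (d\<phi> m x - g x))\<^sup>2) +
        ennreal 2 * ennreal (of_bool (lev (\<phi> m x) \<or> lev (v x)) * (norm (g x))\<^sup>2) \<partial>?M)"
      unfolding level_energy_def
    proof (rule nn_integral_mono)
      fix x
      have "(norm (d\<phi> m x))\<^sup>2 \<le> (norm (d\<phi> m x - g x) + norm (g x))\<^sup>2"
        using norm_triangle_sub[of "d\<phi> m x" "g x"] by (intro power_mono) (auto simp: add.commute)
      also have "\<dots> \<le> 2 * (norm (d\<phi> m x - g x))\<^sup>2 + 2 * (norm (g x))\<^sup>2"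
        using zero_le_power2[of "norm (d\<phi> m x - g x) - norm (g x)"]
        by (simp add: power2_eq_square algebra_simps)
      finally have "of_bool (lev (\<phi> m x)) * (norm (d\<phi> m x))\<^sup>2
         \<le> 2 * (norm (d\<phi> m x - g x))\<^sup>2 + 2 * (of_bool (lev (\<phi> m x) \<or> lev (v x)) * (norm (g x))\<^sup>2)"
        by auto
      then have "ennreal (of_bool (lev (\<phi> m x)) * (norm (d\<phi> m x))\<^sup>2)
         \<le> ennreal (2 * (norm (d\<phi> m x - g x))\<^sup>2 + 2 * (of_bool (lev (\<phi> m x) \<or> lev (v x)) * (norm (g x))\<^sup>2))"
        by (rule ennreal_leI)
      also have "\<dots> = ennreal 2 * ennreal ((norm (d\<phi> m x - g x))\<^sup>2) +
        ennreal 2 * ennreal (of_bool (lev (\<phi> m x) \<or> lev (v x)) * (norm (g x))\<^sup>2)"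
        by (subst ennreal_plus) (auto simp: ennreal_mult)
      finally show "ennreal (of_bool (a \<le> \<bar>\<phi> m x\<bar> \<and> \<bar>\<phi> m x\<bar> \<le> 2 * a) * (norm (d\<phi> m x))\<^sup>2)
        \<le> ennreal 2 * ennreal ((norm (d\<phi> m x - g x))\<^sup>2) +
        ennreal 2 * ennreal (of_bool (lev (\<phi> m x) \<or> lev (v x)) * (norm (g x))\<^sup>2)"
        by (simp only: lev_def)
    qed
    also have "\<dots> = ennreal 2 * D m + ennreal 2 * L m"
      unfolding D_def L_def by (subst nn_integral_add) (auto simp: nn_integral_cmult simp del: ennreal_numeral)
    finally show ?thesis .
  qed
  have Llim: "(\<lambda>m. L (r m)) \<longlonglongrightarrow> level_energy k R a v g"
    unfolding L_def level_energy_def lev_def[symmetric]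
  proof (rule nn_integral_dominated_convergence[where w = "\<lambda>x. ennreal ((norm (g x))\<^sup>2)"])
    show "AE x in ?M. (\<lambda>m. ennreal (of_bool (lev (\<phi> (r m) x) \<or> lev (v x)) * (norm (g x))\<^sup>2))
        \<longlonglongrightarrow> ennreal (of_bool (lev (v x)) * (norm (g x))\<^sup>2)"
      using AEv
    proof eventually_elim
      case (elim x)
      have "eventually (\<lambda>m. (lev (\<phi> (r m) x) \<or> lev (v x)) = lev (v x)) sequentially"
      proof (cases "lev (v x)")
        case False
        then have "\<bar>v x\<bar> < a \<or> 2 * a < \<bar>v x\<bar>" by (auto simp: lev_def)
        moreover have "(\<lambda>m. \<bar>\<phi> (r m) x\<bar>) \<longlonglongrightarrow> \<bar>v x\<bar>" using elim by (rule tendsto_rabs)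
        ultimately have "eventually (\<lambda>m. \<bar>\<phi> (r m) x\<bar> < a) sequentially \<or> eventually (\<lambda>m. 2 * a < \<bar>\<phi> (r m) x\<bar>) sequentially"
          using order_tendstoD by blast
        then have "eventually (\<lambda>m. \<not> lev (\<phi> (r m) x)) sequentially"
          by (auto simp: lev_def elim: eventually_mono)
        then show ?thesis using False by (simp add: eventually_mono)
      qed simp
      then show ?case by (intro tendsto_eventually) (auto elim: eventually_mono)
    qed
  qed (use gfin in \<open>auto intro!: AE_I2 ennreal_leI\<close>)
  define h where "h m = ennreal C * (ennreal 2 * D m + ennreal 2 * L m) + ennreal (8 * R / a\<^sup>2) * B m" for m
  have "(\<lambda>m. h (r m)) \<longlonglongrightarrow> ennreal C * (ennreal 2 * 0 + ennreal 2 * level_energy k R a v g) + ennreal (8 * R / a\<^sup>2) * 0"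
    unfolding h_def using LIMSEQ_subseq_LIMSEQ[OF lim2 r] LIMSEQ_subseq_LIMSEQ[OF lim3 r]
    by (intro tendsto_add ennreal_tendsto_cmult Llim) (auto simp: D_def B_def o_def)
  then have hlim: "(\<lambda>m. h (r m)) \<longlonglongrightarrow> ennreal (2 * C) * level_energy k R a v g"
    using C by (simp add: ennreal_mult mult.assoc mult.left_commute)
  have ev: "eventually (\<lambda>m. (\<integral>\<^sup>+x. of_bool (2 * a \<le> \<bar>\<phi> m x\<bar>) \<partial>?M) \<le> h m) sequentially"
  proof -
    have "eventually (\<lambda>m. weighted_L2_sq k p R (\<phi> m) \<le> ennreal A) sequentially"
      by (rule weighted_L2_sq_limit[OF _ _ lim1 A pos(3) pos(1)]) measurable
    then show ?thesis
    proof eventually_elim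
      case (elim m)
      have [measurable]: "\<phi> m \<in> borel_measurable borel" by (rule bm)
      have "(\<integral>\<^sup>+x. of_bool (2 * a \<le> \<bar>\<phi> m x\<bar>) \<partial>?M)
         = (\<integral>\<^sup>+x. indicator {x \<in> half_ball k R. 2 * a \<le> \<bar>\<phi> m x\<bar>} x \<partial>lborel)"
        unfolding nn_integral_lebesgue_on_half_ball
        by (intro nn_integral_cong) (auto simp: indicator_def)
      also have "\<dots> = emeasure lborel {x \<in> half_ball k R. 2 * a \<le> \<bar>\<phi> m x\<bar>}"
        by (rule nn_integral_indicator) measurable
      also have "\<dots> \<le> ennreal C * level_energy k R a (\<phi> m) (d\<phi> m) + ennreal (8 * R / a\<^sup>2) * B m"
        unfolding C_def B_def by (rule level_estimate_C1[OF \<phi>(2) cd pos A0 \<theta> \<beta> elim])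
      also have "\<dots> \<le> h m" unfolding h_def by (intro add_right_mono mult_left_mono energy) auto
      finally show ?case .
    qed
  qed
  \<comment> \<open>Fatou's lemma. At almost every point the strict inequality for \<open>v\<close>
    passes to the approximations of large index; the equality |v| = 2 a would not.\<close>
  have "(\<integral>\<^sup>+x. of_bool (2 * a < \<bar>v x\<bar>) \<partial>?M) \<le> (\<integral>\<^sup>+x. liminf (\<lambda>m. of_bool (2 * a \<le> \<bar>\<phi> (r m) x\<bar>)) \<partial>?M)"
  proof (rule nn_integral_mono_AE, use AEv in eventually_elim)
    case (elim x)
    show ?case
    proof (cases "2 * a < \<bar>v x\<bar>")
      case True
      have "(\<lambda>m. \<bar>\<phi> (r m) x\<bar>) \<longlonglongrightarrow> \<bar>v x\<bar>" using elim by (rule tendsto_rabs)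
      then have "eventually (\<lambda>m. 2 * a < \<bar>\<phi> (r m) x\<bar>) sequentially" using True by (rule order_tendstoD)
      then have "(\<lambda>m. of_bool (2 * a \<le> \<bar>\<phi> (r m) x\<bar>) :: ennreal) \<longlonglongrightarrow> 1"
        by (intro tendsto_eventually) (auto elim: eventually_mono)
      then have "liminf (\<lambda>m. of_bool (2 * a \<le> \<bar>\<phi> (r m) x\<bar>) :: ennreal) = 1"
        by (intro lim_imp_Liminf) auto
      then show ?thesis by simp
    qed simp
  qed
  also have "\<dots> \<le> liminf (\<lambda>m. \<integral>\<^sup>+x. of_bool (2 * a \<le> \<bar>\<phi> (r m) x\<bar>) \<partial>?M)"
    by (rule nn_integral_liminf) measurable
  also have "\<dots> \<le> liminf (\<lambda>m. h (r m))"
    by (rule Liminf_mono) (rule eventually_subseq[OF r ev])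
  also have "\<dots> = ennreal (2 * C) * level_energy k R a v g"
    using hlim by (intro lim_imp_Liminf) auto
  finally show ?thesis by (simp add: C_def g_def)
qed

text \<open>Summing the level estimate over the dyadic levels \<open>2\<^bsup>j\<^esup>\<close> loses only a constant, because
  each gradient value is counted at most twice.\<close>

lemma spatial_interpolation:
  fixes v :: "real^'n::finite \<Rightarrow> real"
  assumes v: "v \<in> H1_0L k R" and pos: "R > 0" "p \<ge> 0" and \<theta>: "0 \<le> \<theta>" "\<theta> \<le> 1"
    and \<beta>: "\<beta> = 2 * \<theta> / (real CARD('n) + p)"
    and A: "weighted_L2_sq k p R v < ennreal A"
  shows "(\<integral>\<^sup>+x. ennreal (\<bar>v x\<bar> powr (2 + 2 * \<beta>)) \<partial>lebesgue_on (half_ball k R))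
     \<le> ennreal (4 * 4 powr (2 + 2 * \<beta>) * level_const CARD('n) p \<beta> * R powr (2 * (1 - \<theta>)) * A powr \<beta>) * grad_L2_sq k R v"
proof -
  let ?M = "lebesgue_on (half_ball k R)"
  define g where "g = weak_grad (half_ball k R) v"
  define q where "q = 2 + 2 * \<beta>"
  define C where "C = level_const CARD('n) p \<beta> * R powr (2 * (1 - \<theta>)) * A powr \<beta>"
  have C: "C \<ge> 0" unfolding C_def by (intro mult_nonneg_nonneg less_imp_le[OF level_const_pos]) auto
  have q: "q > 0" unfolding q_def \<beta> using \<theta> pos by (intro add_pos_nonneg) auto
  have [measurable]: "v \<in> borel_measurable ?M" "g \<in> borel_measurable ?M"
    using v by (auto simp: H1_0L_def H1_def L2_def g_def)
  define a where "a j = 2 powr real_of_int j" for j :: int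
  have a: "a j > 0" for j by (simp add: a_def)
  have "(\<integral>\<^sup>+x. ennreal (\<bar>v x\<bar> powr q) \<partial>?M)
     \<le> (\<integral>\<^sup>+x. \<integral>\<^sup>+j. ennreal ((4 * a j) powr q) * of_bool (2 * a j < \<bar>v x\<bar>) \<partial>count_space UNIV \<partial>?M)"
  proof (rule nn_integral_mono)
    fix x
    show "ennreal (\<bar>v x\<bar> powr q) \<le> (\<integral>\<^sup>+j. ennreal ((4 * a j) powr q) * of_bool (2 * a j < \<bar>v x\<bar>) \<partial>count_space UNIV)"
    proof (cases "v x = 0")
      case False
      define l where "l = log 2 \<bar>v x\<bar>"
      have vl: "\<bar>v x\<bar> = 2 powr l" using False by (simp add: l_def)
      \<comment> \<open>The only integer with 2 a_j < |v x| \<le> 4 a_j, where a_j = 2^j.\<close>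
      define j where "j = \<lceil>l\<rceil> - 2"
      have j: "real_of_int j + 1 < l" "l \<le> real_of_int j + 2" unfolding j_def by linarith+
      have 1: "2 * a j = 2 powr (real_of_int j + 1)" "4 * a j = 2 powr (real_of_int j + 2)"
        by (simp_all add: a_def powr_add)
      have "2 * a j < \<bar>v x\<bar>" "\<bar>v x\<bar> \<le> 4 * a j" using j unfolding vl 1 by (auto intro: powr_less_mono powr_mono)
      then have "ennreal (\<bar>v x\<bar> powr q) \<le> ennreal ((4 * a j) powr q) * of_bool (2 * a j < \<bar>v x\<bar>)"
        using q by (auto intro!: ennreal_leI powr_mono2)
      also have "\<dots> \<le> (\<integral>\<^sup>+j. ennreal ((4 * a j) powr q) * of_bool (2 * a j < \<bar>v x\<bar>) \<partial>count_space UNIV)"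
        by (rule nn_integral_ge_point) simp
      finally show ?thesis .
    qed simp
  qed
  also have "\<dots> = (\<integral>\<^sup>+j. \<integral>\<^sup>+x. ennreal ((4 * a j) powr q) * of_bool (2 * a j < \<bar>v x\<bar>) \<partial>?M \<partial>count_space UNIV)"
    by (rule nn_integral_count_space_nn_integral) auto
  also have "\<dots> = (\<integral>\<^sup>+j. ennreal ((4 * a j) powr q) * (\<integral>\<^sup>+x. of_bool (2 * a j < \<bar>v x\<bar>) \<partial>?M) \<partial>count_space UNIV)"
    by (intro nn_integral_cong nn_integral_cmult) measurable
  also have "\<dots> \<le> (\<integral>\<^sup>+j. ennreal (2 * 4 powr q * C) * level_energy k R (a j) v g \<partial>count_space UNIV)"
  proof (rule nn_integral_mono)
    fix j
    have "ennreal ((4 * a j) powr q) * (\<integral>\<^sup>+x. of_bool (2 * a j < \<bar>v x\<bar>) \<partial>?M)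
      \<le> ennreal ((4 * a j) powr q) * (ennreal (2 * (C * a j powr (- 2 - 2 * \<beta>))) * level_energy k R (a j) v g)"
      unfolding C_def g_def
      by (intro mult_left_mono level_estimate_H1_0L[OF v pos(1) a pos(2) \<theta> \<beta> A]) auto
    also have "\<dots> = ennreal ((4 * a j) powr q * (2 * (C * a j powr (- 2 - 2 * \<beta>)))) * level_energy k R (a j) v g"
      using C by (simp add: ennreal_mult mult.assoc)
    \<comment> \<open>The exponent \<open>q\<close> is chosen so that the powers of
      \<open>a j\<close> cancel and the coefficient is the same on every level.\<close>
    also have "(4 * a j) powr q * (2 * (C * a j powr (- 2 - 2 * \<beta>))) = 2 * 4 powr q * C"
    proof -
      have "a j powr q * a j powr (- 2 - 2 * \<beta>) = a j powr 0"
        unfolding powr_add[symmetric] q_def by simp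
      then have "a j powr q * a j powr (- 2 - 2 * \<beta>) = 1" using a[of j] by simp
      then show ?thesis using a[of j] by (simp add: powr_mult mult.assoc mult.left_commute)
    qed
    finally show "ennreal ((4 * a j) powr q) * (\<integral>\<^sup>+x. of_bool (2 * a j < \<bar>v x\<bar>) \<partial>?M) \<le> ennreal (2 * 4 powr q * C) * level_energy k R (a j) v g" .
  qed
  also have "\<dots> = ennreal (2 * 4 powr q * C) * (\<integral>\<^sup>+j. level_energy k R (a j) v g \<partial>count_space UNIV)"
    by (rule nn_integral_cmult) simp
  also have "(\<integral>\<^sup>+j. level_energy k R (a j) v g \<partial>count_space UNIV)
     = (\<integral>\<^sup>+x. \<integral>\<^sup>+j. ennreal (of_bool (a j \<le> \<bar>v x\<bar> \<and> \<bar>v x\<bar> \<le> 2 * a j) * (norm (g x))\<^sup>2) \<partial>count_space UNIV \<partial>?M)"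
    unfolding level_energy_def by (rule nn_integral_count_space_nn_integral[symmetric]) auto
  also have "\<dots> \<le> (\<integral>\<^sup>+x. ennreal 2 * ennreal ((norm (g x))\<^sup>2) \<partial>?M)"
  proof (rule nn_integral_mono)
    fix x
    define l where "l = log 2 \<bar>v x\<bar>"
    \<comment> \<open>The shell of level j contains |v x| only if l - 1 \<le> j \<le> l, which
      leaves at most two integers. Membership in a shell forces v x to be nonzero, so the default
      value of the logarithm at zero never enters.\<close>
    have "(\<integral>\<^sup>+j. ennreal (of_bool (a j \<le> \<bar>v x\<bar> \<and> \<bar>v x\<bar> \<le> 2 * a j) * (norm (g x))\<^sup>2) \<partial>count_space UNIV)
       \<le> (\<integral>\<^sup>+j. ennreal ((norm (g x))\<^sup>2) * indicator {\<lfloor>l\<rfloor> - 1, \<lfloor>l\<rfloor>} j \<partial>count_space UNIV)"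
    proof (rule nn_integral_mono)
      fix j
      have "j \<in> {\<lfloor>l\<rfloor> - 1, \<lfloor>l\<rfloor>}" if j: "a j \<le> \<bar>v x\<bar>" "\<bar>v x\<bar> \<le> 2 * a j"
      proof -
        have "\<bar>v x\<bar> > 0" using j a[of j] by linarith
        then have vl: "\<bar>v x\<bar> = 2 powr l" by (simp add: l_def)
        have "2 * a j = 2 powr (real_of_int j + 1)" by (simp add: a_def powr_add)
        then have "real_of_int j \<le> l" "l \<le> real_of_int j + 1" using j unfolding vl by (simp_all add: a_def)
        then have "j \<le> \<lfloor>l\<rfloor>" "\<lfloor>l\<rfloor> \<le> j + 1" by linarith+
        then show ?thesis by auto
      qed
      then show "ennreal (of_bool (a j \<le> \<bar>v x\<bar> \<and> \<bar>v x\<bar> \<le> 2 * a j) * (norm (g x))\<^sup>2)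
        \<le> ennreal ((norm (g x))\<^sup>2) * indicator {\<lfloor>l\<rfloor> - 1, \<lfloor>l\<rfloor>} j"
        by (auto simp: indicator_def)
    qed
    also have "\<dots> = ennreal ((norm (g x))\<^sup>2) * emeasure (count_space UNIV) {\<lfloor>l\<rfloor> - 1, \<lfloor>l\<rfloor>}"
      by (rule nn_integral_cmult_indicator) simp
    also have "\<dots> = ennreal 2 * ennreal ((norm (g x))\<^sup>2)"
      by (simp add: emeasure_count_space mult.commute)
    finally show "(\<integral>\<^sup>+j. ennreal (of_bool (a j \<le> \<bar>v x\<bar> \<and> \<bar>v x\<bar> \<le> 2 * a j) * (norm (g x))\<^sup>2) \<partial>count_space UNIV)
       \<le> ennreal 2 * ennreal ((norm (g x))\<^sup>2)" .
  qed
  also have "\<dots> = ennreal 2 * grad_L2_sq k R v"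
    unfolding grad_L2_sq_def g_def[symmetric] by (rule nn_integral_cmult) measurable
  finally have "(\<integral>\<^sup>+x. ennreal (\<bar>v x\<bar> powr q) \<partial>?M) \<le> ennreal (2 * 4 powr q * C) * (ennreal 2 * grad_L2_sq k R v)"
    by (simp add: mult_left_mono)
  also have "\<dots> = ennreal (4 * 4 powr q * C) * grad_L2_sq k R v"
    unfolding mult.assoc[symmetric] using C by (subst ennreal_mult[symmetric]) (auto simp: mult_ac)
  finally show ?thesis by (simp add: q_def C_def mult.assoc)
qed

section \<open>Slicing the cylinder and integrating in time\<close>

lemma half_cylinder_borel [measurable]: "half_cylinder k R T \<in> sets borel"
  unfolding half_cylinder_def by (rule borel_Times) auto

lemma AE_lebesgue_on_iff:
  fixes S :: "'a::euclidean_space set"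
  assumes "S \<in> sets borel"
  shows "(AE x in lebesgue_on S. P x) \<longleftrightarrow> (AE x in lborel. x \<in> S \<longrightarrow> P x)"
  using assms by (subst AE_restrict_space_iff) (auto simp: AE_completion_iff)

text \<open>The exceptional set is first enclosed in a measurable null set, so that Fubini applies.
  The quantifiers are then exchanged, because the second variable, which is time in the application,
  has to be the outer one.\<close>

lemma AE_lborel_pair_slice:
  fixes P :: "'a::euclidean_space \<times> 'b::euclidean_space \<Rightarrow> bool"
  assumes "AE z in lborel. P z"
  shows "AE y in lborel. AE x in lborel. P (x, y)"
proof -
  obtain N where N: "{z. \<not> P z} \<subseteq> N" "N \<in> null_sets (lborel :: ('a \<times> 'b) measure)"
    using assms by (auto elim!: AE_E simp: null_sets_def)
  then have N': "N \<in> null_sets ((lborel :: 'a measure) \<Otimes>\<^sub>M (lborel :: 'b measure))"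
    by (simp add: lborel_prod)
  then have [measurable]: "N \<in> sets ((lborel :: 'a measure) \<Otimes>\<^sub>M (lborel :: 'b measure))" by auto
  have "AE x in lborel. AE y in lborel. (x, y) \<notin> N"
    using AE_not_in[OF N'] by (rule lborel_pair.AE_pair)
  then have "AE y in lborel. AE x in lborel. (x, y) \<notin> N"
    using sets.compl_sets[OF \<open>N \<in> sets (lborel \<Otimes>\<^sub>M lborel)\<close>]
    by (subst (asm) lborel_pair.AE_commute) (auto simp: set_diff_eq)
  then show ?thesis
    by eventually_elim (use N in \<open>auto elim!: eventually_mono\<close>)
qed

text \<open>The spatial estimate holds at almost every time with one common bound \<open>A\<close>
  for the weighted norms, and is integrated in \<open>t\<close>. This gives A^\<beta> times the
  gradient energy, which for a suitable \<open>A\<close> is at most the power 1 + \<beta> of the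
  squared norm.\<close>

lemma parabolic_interpolation:
  fixes u :: "real^'n::finite \<Rightarrow> real \<Rightarrow> real"
  assumes u: "u \<in> Linf_weighted_L2 k p R T" "u \<in> L2_H1_0L k R T"
    and pos: "R > 0" "T > 0" "p \<ge> 0" and \<theta>: "0 \<le> \<theta>" "\<theta> \<le> 1"
    and \<beta>: "\<beta> = 2 * \<theta> / (real CARD('n) + p)"
  defines "K \<equiv> 4 * 4 powr (2 + 2 * \<beta>) * level_const CARD('n) p \<beta>"
  shows "integrable (lebesgue_on (half_cylinder k R T)) (\<lambda>(x, t). \<bar>u x t\<bar> powr (2 * (1 + \<beta>)))"
    and "(integral\<^sup>L (lebesgue_on (half_cylinder k R T)) (\<lambda>(x, t). \<bar>u x t\<bar> powr (2 * (1 + \<beta>)))) powr (1 / (1 + \<beta>))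
      \<le> K powr (1 / (1 + \<beta>)) * R powr (2 * (1 - \<theta>) / (1 + \<beta>)) * (V2_norm k p R T u)\<^sup>2"
proof -
  define q where "q = 2 + 2 * \<beta>"
  let ?Q = "half_cylinder k R T"
  let ?I = "{-T<..0}"
  let ?\<Omega> = "half_ball k R"
  have q2: "2 * (1 + \<beta>) = q" by (simp add: q_def)
  have \<beta>0: "\<beta> \<ge> 0" unfolding \<beta> using \<theta> pos by (intro divide_nonneg_nonneg) auto
  have K: "K > 0" by (simp add: K_def level_const_pos)
  define F where "F = (\<lambda>(x, t). \<bar>u x t\<bar> powr q)"
  have Fm: "F \<in> borel_measurable (lebesgue_on ?Q)"
  proof -
    have "(\<lambda>(x, t). u x t) \<in> borel_measurable (lebesgue_on ?Q)"
      using u by (simp add: L2_H1_0L_def cylinder_measurable_def)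
    then have "(\<lambda>z. \<bar>(case z of (x, t) \<Rightarrow> u x t)\<bar> powr q) \<in> borel_measurable (lebesgue_on ?Q)"
      by measurable
    then show ?thesis by (simp add: F_def case_prod_unfold)
  qed
  define f where "f z = ennreal (F z) * indicator ?Q z" for z
  have "f \<in> borel_measurable lebesgue"
    unfolding f_def
    using borel_measurable_restrict_space_iff_ennreal[of ?Q lebesgue "\<lambda>z. ennreal (F z)"] Fm
    by simp
  \<comment> \<open>Fubini's theorem is applied to a Borel representative of the Lebesgue measurable
    integrand; on almost every time slice the two agree almost everywhere.\<close>
  then obtain f' where f'm: "f' \<in> borel_measurable lborel" and f': "AE z in lborel. f z = f' z"
    using completion_ex_borel_measurable[of f lborel] by auto
  have [measurable]: "f' \<in> borel_measurable (lborel \<Otimes>\<^sub>M lborel)"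
    using f'm by (simp add: lborel_prod)
  have slices: "AE t in lborel. AE x in lborel. f (x, t) = f' (x, t)"
    by (rule AE_lborel_pair_slice[OF f'])
  define H where "H t = (\<integral>\<^sup>+x. f' (x, t) \<partial>lborel)" for t
  have [measurable]: "H \<in> borel_measurable lborel" unfolding H_def by measurable
  have int: "(\<integral>\<^sup>+z. ennreal (F z) \<partial>lebesgue_on ?Q) = (\<integral>\<^sup>+t. H t \<partial>lborel)"
  proof -
    have "(\<integral>\<^sup>+z. ennreal (F z) \<partial>lebesgue_on ?Q) = (\<integral>\<^sup>+z. f z \<partial>lebesgue)"
      unfolding f_def by (subst nn_integral_restrict_space) auto
    also have "\<dots> = (\<integral>\<^sup>+z. f' z \<partial>lborel)"
      unfolding nn_integral_completion by (rule nn_integral_cong_AE[OF f'])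
    also have "\<dots> = (\<integral>\<^sup>+z. f' z \<partial>(lborel \<Otimes>\<^sub>M lborel))" by (simp add: lborel_prod)
    also have "\<dots> = (\<integral>\<^sup>+t. H t \<partial>lborel)"
      unfolding H_def by (rule lborel_pair.nn_integral_snd[symmetric]) measurable
    finally show ?thesis .
  qed
  define W where "W t = weighted_L2_sq k p R (\<lambda>x. u x t)" for t
  define g where "g t = grad_L2_sq k R (\<lambda>x. u x t)" for t
  define S where "S = esssup (lebesgue_on {-T<..<0}) W"
  define D where "D = (\<integral>\<^sup>+t. g t \<partial>lebesgue_on ?I)"
  have W0: "esssup (lebesgue_on ?I) W < \<infinity>" using u by (simp add: Linf_weighted_L2_def W_def[abs_def])
  \<comment> \<open>The essential supremum of a nonmeasurable function is infinite by convention, so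
    finiteness yields measurability.\<close>
  then have Wm: "W \<in> borel_measurable (lebesgue_on ?I)"
    using esssup_non_measurable by fastforce
  have Wm': "W \<in> borel_measurable (lebesgue_on {-T<..<0})"
    by (rule measurable_restrict_mono[OF Wm]) auto
  have "AE t in lebesgue_on {-T<..<0}. W t \<le> esssup (lebesgue_on ?I) W"
    using esssup_AE[of W "lebesgue_on ?I"] by (auto simp: AE_lebesgue_on_iff elim!: eventually_mono)
  then have "S \<le> esssup (lebesgue_on ?I) W"
    unfolding S_def using Wm' by (intro esssup_I)
  then have Sfin: "S < \<infinity>" using W0 by (rule le_less_trans)
  have Dfin: "D < \<infinity>"
  proof -
    have "D \<le> (\<integral>\<^sup>+t. H1_norm_sq k R (\<lambda>x. u x t) \<partial>lebesgue_on ?I)"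
      unfolding D_def g_def H1_norm_sq_def by (intro nn_integral_mono) simp
    also have "\<dots> < \<infinity>" using u by (simp add: L2_H1_0L_def)
    finally show ?thesis .
  qed
  obtain s d where s: "S = ennreal s" "s \<ge> 0" and d: "D = ennreal d" "d \<ge> 0"
    using Sfin Dfin by (cases S; cases D) auto
  have V2: "(V2_norm k p R T u)\<^sup>2 = s + d"
  proof -
    have "(V2_norm k p R T u)\<^sup>2 = enn2real (S + D)"
      unfolding V2_norm_def S_def D_def W_def[abs_def] g_def by simp
    then show ?thesis using s d by (simp flip: ennreal_plus)
  qed
  \<comment> \<open>The norm takes its supremum over the open interval, while the integral in time
    runs over \<open>?I\<close>; the additional time 0 is a null set.\<close>
  have AES: "AE t in lborel. t \<in> ?I \<longrightarrow> W t \<le> S"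
  proof -
    have "AE t in lborel. t \<in> {-T<..<0} \<longrightarrow> W t \<le> S"
      unfolding S_def using esssup_AE[of W "lebesgue_on {-T<..<0}"] by (simp add: AE_lebesgue_on_iff)
    then show ?thesis
      using AE_lborel_singleton[of "0::real"] by eventually_elim auto
  qed
  have AEu: "AE t in lborel. t \<in> ?I \<longrightarrow> (\<lambda>x. u x t) \<in> H1_0L k R"
    using u by (simp add: L2_H1_0L_def AE_lebesgue_on_iff)
  \<comment> \<open>The spatial estimate asks for a strict bound on the weighted norm, so
    \<open>A\<close> has to exceed the supremum \<open>s\<close>.\<close>
  have bound: "(\<integral>\<^sup>+t. H t \<partial>lborel) \<le> ennreal (K * R powr (2 * (1 - \<theta>)) * A powr \<beta> * d)" if A: "A > s" for A
  proof -
    define c where "c = K * R powr (2 * (1 - \<theta>)) * A powr \<beta>"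
    have c: "c > 0" using K pos A s by (simp add: c_def)
    have "AE t in lborel. H t \<le> ennreal c * (g t * indicator ?I t)"
      using slices AES AEu
    proof eventually_elim
      case (elim t)
      have H: "H t = (\<integral>\<^sup>+x. f (x, t) \<partial>lborel)"
        unfolding H_def using elim(1) by (intro nn_integral_cong_AE) (auto elim: eventually_mono)
      show ?case
      proof (cases "t \<in> ?I")
        case True
        have "H t = (\<integral>\<^sup>+x. ennreal (\<bar>u x t\<bar> powr q) \<partial>lebesgue_on ?\<Omega>)"
          unfolding H nn_integral_lebesgue_on_half_ball f_def F_def using True
          by (intro nn_integral_cong) (auto simp: half_cylinder_def indicator_def)
        also have "\<dots> \<le> ennreal c * g t"
          unfolding q_def c_def K_def g_def
        proof (rule spatial_interpolation[OF _ pos(1,3) \<theta> \<beta>])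
          show "(\<lambda>x. u x t) \<in> H1_0L k R" using elim True by simp
          have "W t \<le> ennreal s" using elim True s by simp
          also have "\<dots> < ennreal A" using A s by (simp add: ennreal_less_iff)
          finally show "weighted_L2_sq k p R (\<lambda>x. u x t) < ennreal A" by (simp add: W_def)
        qed
        finally show ?thesis using True by simp
      next
        case False
        then have "f (x, t) = 0" for x by (simp add: f_def half_cylinder_def)
        then show ?thesis by (simp add: H)
      qed
    qed
    \<comment> \<open>No measurability of \<open>g\<close> in \<open>t\<close> has been established.
      The constant is therefore moved to the side of \<open>H\<close>, which is measurable, and can
      be taken out of the integral there.\<close>
    then have "AE t in lborel. ennreal (1 / c) * H t \<le> g t * indicator ?I t"
    proof eventually_elim
      case (elim t)
      have "ennreal (1 / c) * H t \<le> ennreal (1 / c) * (ennreal c * (g t * indicator ?I t))"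
        by (intro mult_left_mono elim) auto
      also have "\<dots> = g t * indicator ?I t"
        unfolding mult.assoc[symmetric] using c by (subst ennreal_mult[symmetric]) auto
      finally show ?case .
    qed
    then have "(\<integral>\<^sup>+t. ennreal (1 / c) * H t \<partial>lborel) \<le> (\<integral>\<^sup>+t. g t * indicator ?I t \<partial>lborel)"
      by (rule nn_integral_mono_AE)
    also have "\<dots> = D"
      unfolding D_def by (subst nn_integral_restrict_space) (auto simp: nn_integral_completion)
    finally have "ennreal (1 / c) * (\<integral>\<^sup>+t. H t \<partial>lborel) \<le> D"
      by (simp add: nn_integral_cmult)
    then have "ennreal c * (ennreal (1 / c) * (\<integral>\<^sup>+t. H t \<partial>lborel)) \<le> ennreal c * D"
      by (rule mult_left_mono) simp
    also have "ennreal c * (ennreal (1 / c) * (\<integral>\<^sup>+t. H t \<partial>lborel)) = (\<integral>\<^sup>+t. H t \<partial>lborel)"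
      unfolding mult.assoc[symmetric] using c by (subst ennreal_mult[symmetric]) auto
    also have "ennreal c * D = ennreal (c * d)" using c d by (simp add: ennreal_mult)
    finally show ?thesis by (simp add: c_def)
  qed
  have main: "(\<integral>\<^sup>+z. ennreal (F z) \<partial>lebesgue_on ?Q) \<le> ennreal (K * R powr (2 * (1 - \<theta>)) * (s + d) powr (1 + \<beta>))"
  \<comment> \<open>For d > 0 the choice A = s + d, the squared norm, is admissible. For d = 0 any
    admissible \<open>A\<close> makes the right side vanish.\<close>
  proof (cases "d = 0")
    case True
    have "(\<integral>\<^sup>+t. H t \<partial>lborel) \<le> ennreal (K * R powr (2 * (1 - \<theta>)) * (s + 1) powr \<beta> * d)"
      by (rule bound) simp
    then show ?thesis unfolding int by (simp add: True)
  next
    case False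
    then have "(\<integral>\<^sup>+t. H t \<partial>lborel) \<le> ennreal (K * R powr (2 * (1 - \<theta>)) * (s + d) powr \<beta> * d)"
      using d by (intro bound) simp
    also have "\<dots> \<le> ennreal (K * R powr (2 * (1 - \<theta>)) * (s + d) powr (1 + \<beta>))"
    proof (rule ennreal_leI)
      have "(s + d) powr (1 + \<beta>) = (s + d) powr \<beta> * (s + d)" using s d by (simp add: powr_add)
      moreover have "(s + d) powr \<beta> * d \<le> (s + d) powr \<beta> * (s + d)" using s by (intro mult_left_mono) auto
      ultimately show "K * R powr (2 * (1 - \<theta>)) * (s + d) powr \<beta> * d
          \<le> K * R powr (2 * (1 - \<theta>)) * (s + d) powr (1 + \<beta>)"
        using K by (simp add: mult.assoc mult_left_mono)
    qed
    finally show ?thesis unfolding int .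
  qed
  have F0: "F z \<ge> 0" for z by (simp add: F_def split: prod.split)
  have Fint: "integrable (lebesgue_on ?Q) F"
  proof (rule integrableI_nonneg[OF Fm])
    show "(\<integral>\<^sup>+z. ennreal (F z) \<partial>lebesgue_on ?Q) < \<infinity>" using main by (rule le_less_trans) simp
  qed (simp add: F0)
  then show "integrable (lebesgue_on ?Q) (\<lambda>(x, t). \<bar>u x t\<bar> powr (2 * (1 + \<beta>)))"
    by (simp only: q2 F_def)
  have "ennreal (integral\<^sup>L (lebesgue_on ?Q) F) \<le> ennreal (K * R powr (2 * (1 - \<theta>)) * (s + d) powr (1 + \<beta>))"
    using main nn_integral_eq_integral[OF Fint] F0 by simp
  then have "integral\<^sup>L (lebesgue_on ?Q) F \<le> K * R powr (2 * (1 - \<theta>)) * (s + d) powr (1 + \<beta>)"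
    using K by (subst (asm) ennreal_le_iff) auto
  moreover have "integral\<^sup>L (lebesgue_on ?Q) F \<ge> 0" by (simp add: F0)
  ultimately have "(integral\<^sup>L (lebesgue_on ?Q) F) powr (1 / (1 + \<beta>))
     \<le> (K * R powr (2 * (1 - \<theta>)) * (s + d) powr (1 + \<beta>)) powr (1 / (1 + \<beta>))"
    using \<beta>0 by (intro powr_mono2) auto
  also have "\<dots> = K powr (1 / (1 + \<beta>)) * R powr (2 * (1 - \<theta>) / (1 + \<beta>)) * (s + d)"
    using K s d \<beta>0 by (simp add: powr_mult powr_powr)
  finally show "(integral\<^sup>L (lebesgue_on ?Q) (\<lambda>(x, t). \<bar>u x t\<bar> powr (2 * (1 + \<beta>)))) powr (1 / (1 + \<beta>))
      \<le> K powr (1 / (1 + \<beta>)) * R powr (2 * (1 - \<theta>) / (1 + \<beta>)) * (V2_norm k p R T u)\<^sup>2"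
    by (simp only: q2 F_def V2)
qed

section \<open>Choice of the exponents in each dimension\<close>

theorem theorem2p9:
  fixes p :: real
  assumes "p \<ge> 0"
  shows
    "(CARD('n::finite) \<ge> 3 \<longrightarrow>
       (\<exists>C::real. \<forall>(k::'n) R T u. R > 0 \<and> T > 0 \<and>
          u \<in> Linf_weighted_L2 k p R T \<inter> L2_H1_0L k R T \<longrightarrow>
          (let chi = (real CARD('n) + p + 2) / (real CARD('n) + p) in
            integrable (lebesgue_on (half_cylinder k R T)) (\<lambda>(x, t). \<bar>u x t\<bar> powr (2 * chi)) \<and>
            (integral\<^sup>L (lebesgue_on (half_cylinder k R T)) (\<lambda>(x, t). \<bar>u x t\<bar> powr (2 * chi))) powr (1 / chi)
              \<le> C * (V2_norm k p R T u)\<^sup>2)))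
     \<and>
     (\<exists>C::real.
       (\<forall>(k::1) R T u. R > 0 \<and> T > 0 \<and>
          u \<in> Linf_weighted_L2 k p R T \<inter> L2_H1_0L k R T \<longrightarrow>
          (let chi = (p + 2) / (p + 1) in
            integrable (lebesgue_on (half_cylinder k R T)) (\<lambda>(x, t). \<bar>u x t\<bar> powr (2 * chi)) \<and>
            (integral\<^sup>L (lebesgue_on (half_cylinder k R T)) (\<lambda>(x, t). \<bar>u x t\<bar> powr (2 * chi))) powr (1 / chi)
              \<le> C * R powr ((p + 2 - 1) / (p + 2)) * (V2_norm k p R T u)\<^sup>2)) \<and>
       (\<forall>(k::2) R T u. R > 0 \<and> T > 0 \<and>
          u \<in> Linf_weighted_L2 k p R T \<inter> L2_H1_0L k R T \<longrightarrow>
          (let chi = (p + 2) / (p + 1) in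
            integrable (lebesgue_on (half_cylinder k R T)) (\<lambda>(x, t). \<bar>u x t\<bar> powr (2 * chi)) \<and>
            (integral\<^sup>L (lebesgue_on (half_cylinder k R T)) (\<lambda>(x, t). \<bar>u x t\<bar> powr (2 * chi))) powr (1 / chi)
              \<le> C * R powr ((p + 2 - 2) / (p + 2)) * (V2_norm k p R T u)\<^sup>2)))"
proof (intro conjI impI)
  define K where "K n \<beta> = (4 * 4 powr (2 + 2 * \<beta>) * level_const n p \<beta>) powr (1 / (1 + \<beta>))" for n \<beta>
  have K: "K n \<beta> \<ge> 0" for n \<beta> by (simp add: K_def)
  show "\<exists>C::real. \<forall>(k::'n) R T u. R > 0 \<and> T > 0 \<and>
          u \<in> Linf_weighted_L2 k p R T \<inter> L2_H1_0L k R T \<longrightarrow>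
          (let chi = (real CARD('n) + p + 2) / (real CARD('n) + p) in
            integrable (lebesgue_on (half_cylinder k R T)) (\<lambda>(x, t). \<bar>u x t\<bar> powr (2 * chi)) \<and>
            (integral\<^sup>L (lebesgue_on (half_cylinder k R T)) (\<lambda>(x, t). \<bar>u x t\<bar> powr (2 * chi))) powr (1 / chi)
              \<le> C * (V2_norm k p R T u)\<^sup>2)"
  proof -
    \<comment> \<open>The value that belongs to \<theta> = 1. The exponent 2 (1 - \<theta>) of the
      radius is then zero, and the constant is independent of \<open>R\<close>.\<close>
    define \<beta> where "\<beta> = 2 / (real CARD('n) + p)"
    have np: "real CARD('n) + p > 0" using assms by (intro add_pos_nonneg) (auto simp: card_gt_0_iff)
    have chi: "(real CARD('n) + p + 2) / (real CARD('n) + p) = 1 + \<beta>"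
      using np by (simp add: \<beta>_def field_simps)
    show ?thesis
      unfolding chi Let_def
    proof (intro exI[of _ "K CARD('n) \<beta>"] allI impI, elim conjE IntE, intro conjI)
      fix k :: 'n and R T :: real and u
      assume A: "0 < R" "0 < T" "u \<in> Linf_weighted_L2 k p R T" "u \<in> L2_H1_0L k R T"
      note * = parabolic_interpolation[OF A(3,4,1,2) assms, of 1 \<beta>]
      show "integrable (lebesgue_on (half_cylinder k R T)) (\<lambda>(x, t). \<bar>u x t\<bar> powr (2 * (1 + \<beta>)))"
        by (rule *(1)) (auto simp: \<beta>_def)
      show "(integral\<^sup>L (lebesgue_on (half_cylinder k R T)) (\<lambda>(x, t). \<bar>u x t\<bar> powr (2 * (1 + \<beta>)))) powr (1 / (1 + \<beta>))
          \<le> K CARD('n) \<beta> * (V2_norm k p R T u)\<^sup>2"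
        using *(2) A by (simp add: \<beta>_def K_def)
    qed
  qed
  define \<beta> where "\<beta> = 1 / (p + 1)"
  have chi: "(p + 2) / (p + 1) = 1 + \<beta>" using assms by (simp add: \<beta>_def field_simps)
  show "\<exists>C::real.
       (\<forall>(k::1) R T u. R > 0 \<and> T > 0 \<and>
          u \<in> Linf_weighted_L2 k p R T \<inter> L2_H1_0L k R T \<longrightarrow>
          (let chi = (p + 2) / (p + 1) in
            integrable (lebesgue_on (half_cylinder k R T)) (\<lambda>(x, t). \<bar>u x t\<bar> powr (2 * chi)) \<and>
            (integral\<^sup>L (lebesgue_on (half_cylinder k R T)) (\<lambda>(x, t). \<bar>u x t\<bar> powr (2 * chi))) powr (1 / chi)
              \<le> C * R powr ((p + 2 - 1) / (p + 2)) * (V2_norm k p R T u)\<^sup>2)) \<and>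
       (\<forall>(k::2) R T u. R > 0 \<and> T > 0 \<and>
          u \<in> Linf_weighted_L2 k p R T \<inter> L2_H1_0L k R T \<longrightarrow>
          (let chi = (p + 2) / (p + 1) in
            integrable (lebesgue_on (half_cylinder k R T)) (\<lambda>(x, t). \<bar>u x t\<bar> powr (2 * chi)) \<and>
            (integral\<^sup>L (lebesgue_on (half_cylinder k R T)) (\<lambda>(x, t). \<bar>u x t\<bar> powr (2 * chi))) powr (1 / chi)
              \<le> C * R powr ((p + 2 - 2) / (p + 2)) * (V2_norm k p R T u)\<^sup>2))"
    unfolding chi Let_def
  \<comment> \<open>A single constant has to serve both dimensions; the sum of the two nonnegative
    constants dominates each of them.\<close>
  proof (intro exI[of _ "K 1 \<beta> + K 2 \<beta>"] conjI allI impI; elim conjE IntE)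
    have mono: "x \<le> (K 1 \<beta> + K 2 \<beta>) * a * b"
      if "x \<le> K 1 \<beta> * a * b \<or> x \<le> K 2 \<beta> * a * b" "a \<ge> 0" "b \<ge> 0" for x a b
    proof -
      have "0 \<le> K 1 \<beta> * a * b" "0 \<le> K 2 \<beta> * a * b" using K that by auto
      then show ?thesis using that(1) by (auto simp: distrib_right)
    qed
    {
      fix k :: 1 and R T :: real and u
      assume A: "0 < R" "0 < T" "u \<in> Linf_weighted_L2 k p R T" "u \<in> L2_H1_0L k R T"
      \<comment> \<open>In dimension one \<theta> = 1/2 solves 2 \<theta> / (1 + p) = 1 / (p +
        1).\<close>
      note * = parabolic_interpolation[OF A(3,4,1,2) assms, of "1/2" \<beta>]
      have \<beta>: "\<beta> = 2 * (1/2) / (real CARD(1) + p)" by (simp add: \<beta>_def add.commute)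
      show "integrable (lebesgue_on (half_cylinder k R T)) (\<lambda>(x, t). \<bar>u x t\<bar> powr (2 * (1 + \<beta>)))"
        by (rule *(1)[OF _ _ \<beta>]) auto
      have e: "2 * (1 - 1/2) / (1 + \<beta>) = (p + 2 - 1) / (p + 2)"
        unfolding chi[symmetric] using assms by (simp add: field_simps)
      show "(integral\<^sup>L (lebesgue_on (half_cylinder k R T)) (\<lambda>(x, t). \<bar>u x t\<bar> powr (2 * (1 + \<beta>)))) powr (1 / (1 + \<beta>))
          \<le> (K 1 \<beta> + K 2 \<beta>) * R powr ((p + 2 - 1) / (p + 2)) * (V2_norm k p R T u)\<^sup>2"
        by (rule mono) (use *(2)[OF _ _ \<beta>, unfolded e] in \<open>auto simp: K_def\<close>)
    next
      fix k :: 2 and R T :: real and u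
      assume A: "0 < R" "0 < T" "u \<in> Linf_weighted_L2 k p R T" "u \<in> L2_H1_0L k R T"
      \<comment> \<open>In dimension two this solves 2 \<theta> / (2 + p) = 1 / (p + 1); it is at
        most 1 because p \<ge> 0.\<close>
      define \<theta> where "\<theta> = (p + 2) / (2 * (p + 1))"
      have \<theta>: "0 \<le> \<theta>" "\<theta> \<le> 1" using assms by (auto simp: \<theta>_def field_simps)
      note * = parabolic_interpolation[OF A(3,4,1,2) assms \<theta>]
      have \<beta>: "\<beta> = 2 * \<theta> / (real CARD(2) + p)"
        using assms by (simp add: \<beta>_def \<theta>_def divide_simps) (simp add: algebra_simps)
      show "integrable (lebesgue_on (half_cylinder k R T)) (\<lambda>(x, t). \<bar>u x t\<bar> powr (2 * (1 + \<beta>)))"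
        by (rule *(1)[OF \<beta>])
      have e: "2 * (1 - \<theta>) / (1 + \<beta>) = (p + 2 - 2) / (p + 2)"
      proof -
        have "2 * (1 - \<theta>) = p / (p + 1)" using assms by (simp add: \<theta>_def field_simps)
        then show ?thesis unfolding chi[symmetric] using assms by (simp add: field_simps)
      qed
      show "(integral\<^sup>L (lebesgue_on (half_cylinder k R T)) (\<lambda>(x, t). \<bar>u x t\<bar> powr (2 * (1 + \<beta>)))) powr (1 / (1 + \<beta>))
          \<le> (K 1 \<beta> + K 2 \<beta>) * R powr ((p + 2 - 2) / (p + 2)) * (V2_norm k p R T u)\<^sup>2"
        by (rule mono) (use *(2)[OF \<beta>, unfolded e] in \<open>auto simp: K_def\<close>)
    }
  qed
qed

end
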